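(* Let $t$ be a prime power, $q=t^2$, and let $\mathcal{X}\subset\mathbb{P}^4(\mathbb{F}_q)$ be the hermitian variety $x_0^{t+1}+x_1^{t+1}+x_2^{t+1}+x_3^{t+1}+x_4^{t+1}=0$. The code $C_2(\mathcal{X})$ is an $[n,k,d]_q$-code (length $n$, dimension $k$, minimum distance $d$) with $$n=(t^2+1)(t^5+1),\qquad k=15,\qquad d=t^7-t^5-t^3-t^2.$$
   Context: Functional code: let $\mathcal{F}_2$ be the $\mathbb{F}_q$-vector space of forms of degree 2 in $x_0,\dots,x_4$ (with $0$). The code $C_2(\mathcal{X})$ is the image of the linear map $c:\mathcal{F}_2\to\mathbb{F}_q^{|\mathcal{X}|}$, $c(f)=(c_x(f))_{x\in\mathcal{X}(\mathbb{F}_q)}$, where $c_x(f)=f(x_0,\dots,x_4)/x_i^2$ for $x=(x_0:\dots:x_4)$ and $i$ the smallest index with $x_i\ne0$. The length is $\#\mathcal{X}(\mathbb{F}_q)$; the weight of $c(f)$ is $\#\mathcal{X}(\mathbb{F}_q)-\#(\mathcal{X}\cap Z(f))(\mathbb{F}_q)$, where $Z(f)$ is the zero set of $f$ in $\mathbb{P}^4(\mathbb{F}_q)$; the minimum distance is the smallest weight of a nonzero codeword. *)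

theory Defs
  imports
    "HOL-Analysis.Analysis"
    "HOL-Library.Poly_Mapping"
    "HOL-Library.Function_Algebras"
    "HOL-Number_Theory.Prime_Powers"
begin

section \<open>Projective 4-space\<close>

text \<open>The homogeneous coordinates \<open>x\<^sub>0, \<dots>, x\<^sub>4\<close> are indexed by the numeral type \<^typ>\<open>5\<close>, whose elements
  \<open>0 < 1 < 2 < 3 < 4\<close> are linearly ordered.\<close>

definition proportional :: "'a::field ^ 5 \<Rightarrow> 'a ^ 5 \<Rightarrow> bool" where
  "proportional x y \<longleftrightarrow> x \<noteq> 0 \<and> y \<noteq> 0 \<and> (\<exists>c. c \<noteq> 0 \<and> y = c *s x)"

lemma part_equivp_proportional: "part_equivp (proportional :: 'a::field ^ 5 \<Rightarrow> _)"
proof (rule part_equivpI)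
  show "\<exists>x :: 'a ^ 5. proportional x x"
    by (rule exI[of _ 1]) (auto simp: proportional_def vec_eq_iff intro!: exI[of _ 1])
  show "symp (proportional :: 'a ^ 5 \<Rightarrow> _)"
  proof (rule sympI)
    fix x y :: "'a ^ 5" assume "proportional x y"
    then obtain c where c: "x \<noteq> 0" "y \<noteq> 0" "c \<noteq> 0" "y = c *s x"
      by (auto simp: proportional_def)
    hence "x = inverse c *s y" by (simp add: vector_smult_assoc)
    with c show "proportional y x"
      unfolding proportional_def by (metis inverse_nonzero_iff_nonzero)
  qed
  show "transp (proportional :: 'a ^ 5 \<Rightarrow> _)"
  proof (rule transpI)
    fix x y z :: "'a ^ 5" assume "proportional x y" "proportional y z"
    then obtain c d where "x \<noteq> 0" "y \<noteq> 0" "z \<noteq> 0" "c \<noteq> 0" "d \<noteq> 0" "y = c *s x" "z = d *s y"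
      by (auto simp: proportional_def)
    moreover have "d *s (c *s x) = (d * c) *s x" by (simp add: vector_smult_assoc)
    ultimately show "proportional x z"
      unfolding proportional_def by (metis mult_eq_0_iff)
  qed
qed

text \<open>Points of \<open>\<bbbP>\<^sup>4\<close>; \<open>abs_proj4 x\<close> is \<open>(x\<^sub>0 : \<dots> : x\<^sub>4)\<close> for \<open>x \<noteq> 0\<close> (and unspecified for \<open>x = 0\<close>).\<close>

quotient_type (overloaded) 'a proj4 = "'a::field ^ 5" / partial: proportional
  by (rule part_equivp_proportional)

definition hermitian_variety :: "nat \<Rightarrow> 'a::field proj4 set" where
  "hermitian_variety t = abs_proj4 ` {x. x \<noteq> 0 \<and> (\<Sum>i\<in>UNIV. x $ i ^ (t + 1)) = 0}"

section \<open>Forms\<close>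

text \<open>A polynomial in \<open>x\<^sub>0, \<dots>, x\<^sub>4\<close> is a finitely supported map from exponent vectors to
  coefficients.\<close>

type_synonym 'a poly5 = "(5 \<Rightarrow>\<^sub>0 nat) \<Rightarrow>\<^sub>0 'a"

definition forms :: "nat \<Rightarrow> 'a::field poly5 set" where
  "forms h = {f. \<forall>m\<in>Poly_Mapping.keys f. (\<Sum>i\<in>UNIV. Poly_Mapping.lookup m i) = h}"

definition poly5_eval :: "'a::field poly5 \<Rightarrow> 'a ^ 5 \<Rightarrow> 'a" where
  "poly5_eval f x =
     (\<Sum>m\<in>Poly_Mapping.keys f. Poly_Mapping.lookup f m * (\<Prod>i\<in>UNIV. x $ i ^ Poly_Mapping.lookup m i))"

definition zero_set :: "'a::field poly5 \<Rightarrow> 'a proj4 set" where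
  "zero_set f = abs_proj4 ` {x. x \<noteq> 0 \<and> poly5_eval f x = 0}"

definition normalized_value :: "nat \<Rightarrow> 'a::field poly5 \<Rightarrow> 'a ^ 5 \<Rightarrow> 'a" where
  "normalized_value h f x = poly5_eval f x / (x $ (LEAST i. x $ i \<noteq> 0)) ^ h"

text \<open>The value \<open>c\<^sub>P(f)\<close> for a form \<open>f\<close> of degree \<open>h\<close> does not depend on the
  representative of \<open>P\<close>, see \<open>point_value_abs\<close> below.\<close>

definition point_value :: "nat \<Rightarrow> 'a::field poly5 \<Rightarrow> 'a proj4 \<Rightarrow> 'a" where
  "point_value h f P = normalized_value h f (rep_proj4 P)"

section \<open>Codes\<close>

text \<open>A word of \<open>F\<^sup>X\<close> is a function on all points that vanishes outside \<open>X\<close>; addition and zero are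
  pointwise.\<close>

definition words :: "'p set \<Rightarrow> ('p \<Rightarrow> 'a::field) set" where
  "words X = {w. \<forall>P. P \<notin> X \<longrightarrow> w P = 0}"

definition word_scale :: "'a::field \<Rightarrow> ('p \<Rightarrow> 'a) \<Rightarrow> 'p \<Rightarrow> 'a" where
  "word_scale a w = (\<lambda>P. a * w P)"

global_interpretation word: vector_space "word_scale :: 'a::field \<Rightarrow> ('p \<Rightarrow> 'a) \<Rightarrow> 'p \<Rightarrow> 'a"
  by standard (auto simp: word_scale_def fun_eq_iff algebra_simps)

definition weight :: "('p \<Rightarrow> 'a::field) \<Rightarrow> nat" where
  "weight w = card {P. w P \<noteq> 0}"

definition min_distance :: "('p \<Rightarrow> 'a::field) set \<Rightarrow> nat" where
  "min_distance C = Min (weight ` (C - {0}))"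

text \<open>\<open>C\<close> is a linear \<open>[n, k, d]\<close>-code with coordinate positions \<open>X\<close>.\<close>

definition is_code ::
    "'p set \<Rightarrow> ('p \<Rightarrow> 'a::field) set \<Rightarrow> nat \<Rightarrow> nat \<Rightarrow> nat \<Rightarrow> bool" where
  "is_code X C n k d \<longleftrightarrow>
     finite X \<and> C \<subseteq> words X \<and> word.subspace C \<and>
     card X = n \<and> word.dim C = k \<and> min_distance C = d"

definition codeword :: "nat \<Rightarrow> 'a::field proj4 set \<Rightarrow> 'a poly5 \<Rightarrow> 'a proj4 \<Rightarrow> 'a" where
  "codeword h X f = (\<lambda>P. if P \<in> X then point_value h f P else 0)"

definition functional_code :: "nat \<Rightarrow> 'a::field proj4 set \<Rightarrow> ('a proj4 \<Rightarrow> 'a) set" where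
  "functional_code h X = codeword h X ` forms h"

section \<open>Independence of representatives and the weight formula\<close>

lemma poly5_eval_scale:
  assumes "f \<in> forms h"
  shows "poly5_eval f (c *s x) = c ^ h * poly5_eval f x"
proof -
  have "Poly_Mapping.lookup f m * (\<Prod>i\<in>UNIV. (c *s x) $ i ^ Poly_Mapping.lookup m i) =
        c ^ h * (Poly_Mapping.lookup f m * (\<Prod>i\<in>UNIV. x $ i ^ Poly_Mapping.lookup m i))"
    if "m \<in> Poly_Mapping.keys f" for m
    using assms that
    by (auto simp: forms_def power_mult_distrib prod.distrib power_sum[symmetric])
  thus ?thesis
    unfolding poly5_eval_def sum_distrib_left by (rule sum.cong[OF refl])
qed

lemma normalized_value_scale:
  assumes "f \<in> forms h" "c \<noteq> 0"
  shows "normalized_value h f (c *s x) = normalized_value h f x"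
  using assms by (simp add: normalized_value_def poly5_eval_scale power_mult_distrib)

lemma proj4_cases:
  obtains x where "x \<noteq> 0" "P = abs_proj4 x"
proof
  have "proportional (rep_proj4 P) (rep_proj4 P)"
    by (rule Quotient3_rep_reflp[OF Quotient3_proj4])
  thus "rep_proj4 P \<noteq> 0" by (simp add: proportional_def)
  show "P = abs_proj4 (rep_proj4 P)"
    by (simp add: Quotient3_abs_rep[OF Quotient3_proj4])
qed

lemma proportional_refl: "x \<noteq> 0 \<Longrightarrow> proportional x x"
  by (auto simp: proportional_def intro!: exI[of _ 1])

lemma proportional_rep_abs: "x \<noteq> 0 \<Longrightarrow> proportional x (rep_proj4 (abs_proj4 x))"
  using rep_abs_rsp[OF Quotient3_proj4 proportional_refl] .

lemma abs_proj4_eq_iff: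
  "x \<noteq> 0 \<Longrightarrow> y \<noteq> 0 \<Longrightarrow> abs_proj4 x = abs_proj4 y \<longleftrightarrow> proportional x y"
  using Quotient3_rel[OF Quotient3_proj4, of x y] by (auto simp: proportional_refl)

lemma point_value_abs:
  assumes "f \<in> forms h" "x \<noteq> 0"
  shows "point_value h f (abs_proj4 x) = poly5_eval f x / (x $ (LEAST i. x $ i \<noteq> 0)) ^ h"
proof -
  obtain c where "c \<noteq> 0" "rep_proj4 (abs_proj4 x) = c *s x"
    using proportional_rep_abs[OF assms(2)] by (auto simp: proportional_def)
  thus ?thesis
    using normalized_value_scale[OF assms(1)] by (simp add: point_value_def normalized_value_def)
qed

lemma leading_coordinate_nonzero:
  fixes x :: "'a::field ^ 5"
  assumes "x \<noteq> 0"
  shows "x $ (LEAST i. x $ i \<noteq> 0) \<noteq> 0"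
proof -
  let ?S = "{i. x $ i \<noteq> 0}"
  have ne: "?S \<noteq> {}" using assms by (auto simp: vec_eq_iff)
  have "(LEAST i. x $ i \<noteq> 0) = Min ?S"
    by (rule Least_equality) (use ne Min_in[of ?S] in auto)
  thus ?thesis using Min_in[of ?S] ne by auto
qed

lemma point_value_eq_0_iff:
  assumes "f \<in> forms h"
  shows "point_value h f P = 0 \<longleftrightarrow> P \<in> zero_set f"
proof -
  obtain x where x: "x \<noteq> 0" "P = abs_proj4 x" by (rule proj4_cases)
  have "P \<in> zero_set f \<longleftrightarrow> poly5_eval f x = 0"
  proof
    assume "P \<in> zero_set f"
    then obtain y where y: "y \<noteq> 0" "poly5_eval f y = 0" "abs_proj4 y = abs_proj4 x"
      using x by (auto simp: zero_set_def)
    then obtain c where "x = c *s y"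
      using x abs_proj4_eq_iff[of y x] by (auto simp: proportional_def)
    thus "poly5_eval f x = 0" using y poly5_eval_scale[OF assms] by simp
  qed (use x in \<open>auto simp: zero_set_def\<close>)
  thus ?thesis
    using x leading_coordinate_nonzero[OF x(1)] by (simp add: point_value_abs[OF assms])
qed

lemma weight_codeword:
  assumes "f \<in> forms h" "finite X"
  shows "weight (codeword h X f) = card X - card (X \<inter> zero_set f)"
proof -
  have "{P. codeword h X f P \<noteq> 0} = X - X \<inter> zero_set f"
    using point_value_eq_0_iff[OF assms(1)] by (auto simp: codeword_def)
  thus ?thesis using assms(2) by (simp add: weight_def card_Diff_subset)
qed

end

theory Submission
  imports Defs
begin

text \<open>Let \<open>H\<close> be the hermitian form and \<open>h(x) = H(x, x)\<close>. The minimum distance amounts to a bound on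
  the number of common zeros of \<open>h\<close> and a nonzero quadratic form \<open>f\<close>; it is attained by a product of two
  coordinates. Everything is counted along translates \<open>x + c R\<close>: \<open>h\<close> has at most \<open>t + 1\<close> zeros there if
  \<open>h(R) \<noteq> 0\<close>, and exactly \<open>t\<close> if \<open>h(R) = 0 \<noteq> H(x, R)\<close>. If \<open>f\<close> vanishes on a hyperplane, it is a product
  of two linear forms, and the sections of the hermitian variety by hyperplanes and planes are
  computed exactly. Otherwise, if \<open>f\<close> has a singular zero \<open>V\<close>, one takes \<open>R = V\<close>. If \<open>f\<close> is nonsingular
  and has a zero, it is \<open>a d + b e + \<gamma> c\<^sup>2\<close> in suitable coordinates and contains a line that is not on
  the hermitian variety; one then lets \<open>R\<close> run through the points of that line.\<close>

section \<open>Finite fields of square order\<close>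

text \<open>Only a product of two linear forms can reach the leading term \<open>2 t^7\<close>, so
  only there are exact section counts needed. A quadric containing no hyperplane has at most
  \<open>t^8 + t^6\<close> vectors, and roughly one in \<open>t\<close> of them is isotropic; its
  count starts with \<open>t^7\<close>, and cruder estimates suffice. The obstacle is translates
  lying wholly on the hermitian variety, which contribute \<open>t^2\<close> instead of about
  \<open>t\<close>: they must be shown to be few. If the line of directions \<open>R\<close> lay on
  the hermitian variety, every \<open>R\<close> would be isotropic and orthogonal to the whole line,
  and nothing would limit such translates; hence the search for a line off it. The margin is
  smallest at \<open>t = 2\<close>, where \<open>2 t^6 = t^7\<close>. Vectors are counted instead of
  points, so that translates need no special treatment. The dimension comes from the same bound:
  since every nonzero form has positive weight, evaluation is injective on forms.\<close>

lemma card_fibre_exact: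
  assumes "finite D" "finite I" "f ` D \<subseteq> I"
    and le: "\<And>c. c \<in> I \<Longrightarrow> card {x\<in>D. f x = c} \<le> k"
    and "card D = k * m" "card I \<le> m" "c \<in> I"
  shows "card {x\<in>D. f x = c} = k"
proof (rule ccontr)
  assume "card {x\<in>D. f x = c} \<noteq> k"
  with le[OF \<open>c \<in> I\<close>] have lt: "card {x\<in>D. f x = c} < k" by simp
  \<comment> \<open>The fibres partition \<open>D\<close>, so one fibre below \<open>k\<close> would
    leave fewer than \<open>k * m\<close> elements. This turns upper bounds from polynomial degrees
    into exact counts.\<close>
  have "card D = (\<Sum>c\<in>I. card {x\<in>D. f x = c})"
    using sum.group[OF assms(1-3), of "\<lambda>_. 1 :: nat"] by simp
  also have "\<dots> < (\<Sum>c\<in>I. k)"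
    using assms lt by (intro sum_strict_mono_ex1) auto
  also have "\<dots> \<le> k * m"
    using assms by (simp add: mult.commute)
  finally show False using assms by simp
qed

lemma card_roots_binomial:
  fixes c :: "'a::idom"
  assumes "n > 0"
  shows "card {x. x ^ n = c} \<le> n"
proof -
  let ?p = "monom 1 n - [:c:]"
  have deg: "degree ?p = n"
    using assms degree_add_eq_left[of "- [:c:]" "monom 1 n"] by (simp add: degree_monom_eq diff_conv_add_uminus del: add_uminus_conv_diff)
  hence "?p \<noteq> 0" using assms by auto
  from card_poly_roots_bound[OF this] show ?thesis
    unfolding deg by (simp add: poly_monom)
qed

lemma card_roots_trinomial:
  fixes a b :: "'a::idom"
  assumes "n > 1"
  shows "card {x. x ^ n + a * x + b = 0} \<le> n"
proof -
  let ?p = "monom 1 n + [:b, a:]"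
  have deg: "degree ?p = n"
    using assms by (subst degree_add_eq_left) (auto simp: degree_monom_eq)
  hence "?p \<noteq> 0" using assms by auto
  from card_poly_roots_bound[OF this] show ?thesis
    unfolding deg by (simp add: poly_monom algebra_simps)
qed

lemma card_roots_quadratic:
  fixes a b c :: "'a::idom"
  assumes "a \<noteq> 0 \<or> b \<noteq> 0"
  shows "card {x. a * x\<^sup>2 + b * x + c = 0} \<le> 2"
proof -
  have "[:c, b, a:] \<noteq> 0" using assms by auto
  from card_poly_roots_bound[OF this]
  have "card {x. a * x\<^sup>2 + b * x + c = 0} \<le> degree [:c, b, a:]"
    by (simp add: algebra_simps power2_eq_square)
  also have "\<dots> \<le> 2" by (simp add: degree_pCons_le)
  finally show ?thesis .
qed

locale square_field =
  fixes t :: nat and ty :: "'a::{field,finite} itself"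
  assumes primepow_t: "primepow t" and card_field: "CARD('a) = t\<^sup>2"
begin

lemma t_ge_2: "t \<ge> 2"
  using primepow_gt_Suc_0[OF primepow_t] by simp

lemma power_card: "(x::'a) ^ t\<^sup>2 = x"
proof (cases "x = 0")
  case False
  \<comment> \<open>Multiplication by \<open>x\<close> permutes the nonzero elements.\<close>
  have "(\<Prod>y\<in>UNIV-{0}. x * y) = (\<Prod>y\<in>UNIV-{0::'a}. y)"
    by (rule prod.reindex_bij_witness[of _ "\<lambda>y. y / x" "\<lambda>y. x * y"]) (use False in auto)
  moreover have "(\<Prod>y\<in>UNIV-{0::'a}. y) \<noteq> 0" by simp
  ultimately have "x ^ card (UNIV - {0::'a}) = 1"
    by (simp add: prod.distrib)
  moreover have "Suc (card (UNIV - {0::'a})) = t\<^sup>2"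
    using t_ge_2 card_Suc_Diff1[of UNIV "0::'a"] by (simp add: card_field)
  ultimately show ?thesis by (metis mult.right_neutral power_Suc)
qed (use t_ge_2 in auto)

lemma power_t_power_t: "((x::'a) ^ t) ^ t = x"
  using power_card[of x] by (simp add: power2_eq_square power_mult)

lemma char_power: "prime CHAR('a)" "\<exists>k. t = CHAR('a) ^ k"
proof -
  have "CHAR('a) > 0" by (intro finite_imp_CHAR_pos) auto
  thus p: "prime CHAR('a)" by (rule prime_CHAR_semidom)
  obtain r k where r: "prime r" "k > 0" "t = r ^ k"
    using primepow_t by (auto simp: primepow_def)
  \<comment> \<open>Translation by 1 permutes the field, so the field order is 0 in it. Hence the
    characteristic is the prime below \<open>t\<close>, which makes \<open>x ^ t\<close>
    additive.\<close>
  have "(\<Sum>x\<in>UNIV. x + 1) = (\<Sum>x\<in>UNIV. x :: 'a)"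
    by (rule sum.reindex_bij_witness[of _ "\<lambda>x. x - 1" "\<lambda>x. x + 1"]) auto
  hence "of_nat CARD('a) = (0::'a)" by (simp add: sum.distrib)
  hence "CHAR('a) dvd CARD('a)" by (simp add: of_nat_eq_0_iff_char_dvd)
  hence "CHAR('a) dvd r"
    unfolding card_field r using prime_dvd_power[OF p] by blast
  with p r(1) have "CHAR('a) = r" by (metis primes_dvd_imp_eq)
  with r show "\<exists>k. t = CHAR('a) ^ k" by blast
qed

lemma frobenius_add: "((x::'a) + y) ^ t = x ^ t + y ^ t"
  using char_power freshmans_dream'[where 'a = 'a] by blast

lemma frobenius_sum: "(sum (f :: 'b \<Rightarrow> 'a) A) ^ t = (\<Sum>i\<in>A. f i ^ t)"
  using char_power freshmans_dream_sum'[where 'a = 'a] by blast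

lemma zero_power_t [simp]: "(0::'a) ^ t = 0"
  using t_ge_2 by simp

lemma frobenius_minus: "(- (x::'a)) ^ t = - (x ^ t)"
  using frobenius_add[of x "-x"] by (simp add: eq_neg_iff_add_eq_0 add.commute)

lemma frobenius_diff: "((x::'a) - y) ^ t = x ^ t - y ^ t"
  using frobenius_add[of x "-y"] by (simp add: frobenius_minus)

lemma card_fixed: "card {c::'a. c ^ t = c} \<le> t"
  using card_roots_trinomial[of t "-1::'a" 0] t_ge_2 by simp

text \<open>Such an element separates \<open>d ^ t\<close> from \<open>d\<close> in the nonsingular
  case, where an identity \<open>d ^ t * a = d * b\<close> for all \<open>d\<close> has to force
  \<open>a = b = 0\<close>.\<close>

lemma exists_not_fixed: "\<exists>c::'a. c ^ t \<noteq> c"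
proof (rule ccontr)
  assume "\<not> (\<exists>c::'a. c ^ t \<noteq> c)"
  hence "{c::'a. c ^ t = c} = UNIV" by auto
  with card_fixed have "t\<^sup>2 \<le> t" by (simp add: card_field)
  with t_ge_2 show False by (simp add: power2_eq_square)
qed

text \<open>The norm sends \<open>t^2 - 1 = (t + 1) (t - 1)\<close> nonzero elements to at most
  \<open>t - 1\<close> values with fibres of size at most \<open>t + 1\<close>, so all fibres are
  full.\<close>

lemma card_norm_fibre:
  assumes "(c::'a) \<noteq> 0" "c ^ t = c"
  shows "card {x. x ^ (t + 1) = c} = t + 1"
proof -
  have "card {x\<in>UNIV - {0::'a}. x ^ (t + 1) = c} = t + 1"
  proof (rule card_fibre_exact[where f = "\<lambda>x. x ^ (t + 1)" and I = "{c. c ^ t = c} - {0}" and m = "t - 1"])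
    show "(\<lambda>x::'a. x ^ (t + 1)) ` (UNIV - {0}) \<subseteq> {c. c ^ t = c} - {0}"
      by (auto simp: power_mult_distrib power_t_power_t mult.commute)
    show "card {x \<in> UNIV - {0}. x ^ (t + 1) = c} \<le> t + 1" for c :: 'a
      by (rule order_trans[OF card_mono card_roots_binomial[of "t + 1" c]]) auto
    have "{0} \<subseteq> {c::'a. c ^ t = c}" by simp
    with card_fixed show "card ({c::'a. c ^ t = c} - {0}) \<le> t - 1"
      by (subst card_Diff_subset) auto
    show "card (UNIV - {0::'a}) = (t + 1) * (t - 1)"
      by (simp add: card_field algebra_simps power2_eq_square card_Diff_subset)
  qed (use assms in auto)
  moreover have "{x\<in>UNIV - {0::'a}. x ^ (t + 1) = c} = {x. x ^ (t + 1) = c}"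
    using assms by auto
  ultimately show ?thesis by simp
qed

text \<open>The same pigeonhole for the trace: \<open>t^2\<close> elements, at most \<open>t\<close>
  values, fibres of size at most \<open>t\<close>.\<close>

lemma card_trace_fibre:
  assumes "(c::'a) ^ t = c"
  shows "card {x. x ^ t + x = c} = t"
proof -
  have "card {x\<in>UNIV. x ^ t + x = c} = t"
  proof (rule card_fibre_exact[where f = "\<lambda>x. x ^ t + x" and I = "{c. c ^ t = c}" and m = t])
    show "range (\<lambda>x::'a. x ^ t + x) \<subseteq> {c. c ^ t = c}"
      by (auto simp: frobenius_add power_t_power_t)
    show "card {x \<in> UNIV. x ^ t + x = c} \<le> t" for c :: 'a
      using card_roots_trinomial[of t 1 "-c"] t_ge_2 by simp
  qed (use assms card_fixed in \<open>auto simp: card_field power2_eq_square\<close>)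
  thus ?thesis by simp
qed

end

section \<open>Counting along translates\<close>

definition linear_form :: "('a::field ^ 'n \<Rightarrow> 'a) \<Rightarrow> bool" where
  "linear_form l \<longleftrightarrow> (\<forall>x y. l (x + y) = l x + l y) \<and> (\<forall>c x. l (c *s x) = c * l x)"

lemma linear_form_add: "linear_form l \<Longrightarrow> l (x + y) = l x + l y"
  and linear_form_scale: "linear_form l \<Longrightarrow> l (c *s x) = c * l x"
  by (auto simp: linear_form_def)

lemma linear_form_0: "linear_form l \<Longrightarrow> l 0 = 0"
  using linear_form_scale[of l 0 0] by simp

lemma linear_form_diff: "linear_form l \<Longrightarrow> l (x - y) = l x - l y"
  using linear_form_add[of l "x - y" y] by simp

lemma linear_form_sum: "linear_form l \<Longrightarrow> l (sum f A) = (\<Sum>i\<in>A. l (f i))"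
  by (induction A rule: infinite_finite_induct) (auto simp: linear_form_0 linear_form_add)

lemma subspace_kernel:
  assumes "vec.subspace U" "linear_form l"
  shows "vec.subspace {x\<in>U. l x = 0}"
  using assms by (auto simp: vec.subspace_def linear_form_0 linear_form_add linear_form_scale)

text \<open>Double counting of the pairs \<open>(x, c)\<close>: for each \<open>c\<close>,
  translation by \<open>c *s R\<close> permutes \<open>S\<close>. It reduces the counts below to
  equations in the single variable \<open>c\<close>.\<close>

lemma sum_card_translates:
  fixes R :: "'a::{field,finite} ^ 'n"
  assumes "\<And>x c. x \<in> S \<Longrightarrow> x + c *s R \<in> S"
  shows "(\<Sum>x\<in>S. card {c. P (x + c *s R)}) = CARD('a) * card {x\<in>S. P x}"
proof -
  have shift: "card {x\<in>S. P (x + c *s R)} = card {x\<in>S. P x}" for c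
    by (rule bij_betw_same_card[OF bij_betw_byWitness[where f = "\<lambda>x. x + c *s R" and f' = "\<lambda>x. x + (- c) *s R"]])
       (use assms assms[where c = "- c"] in \<open>auto simp: vector_smult_lneg\<close>)
  have "(\<Sum>x\<in>S. card {c. P (x + c *s R)}) = (\<Sum>x\<in>S. \<Sum>c\<in>UNIV. of_bool (P (x + c *s R)))"
    by simp
  also have "\<dots> = (\<Sum>c\<in>UNIV. \<Sum>x\<in>S. of_bool (P (x + c *s R)))"
    by (rule sum.swap)
  also have "\<dots> = (\<Sum>c\<in>(UNIV::'a set). card {x\<in>S. P (x + c *s R)})"
    by (simp add: Int_def)
  finally show ?thesis by (simp add: shift)
qed

lemma card_kernel:
  fixes l :: "'a::{field,finite} ^ 'n \<Rightarrow> 'a"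
  assumes "vec.subspace U" "linear_form l" "w \<in> U" "l w \<noteq> 0"
  shows "card U = CARD('a) * card {x\<in>U. l x = 0}"
proof -
  have "{c. l (x + c *s w) = 0} = {- l x / l w}" for x
    using assms by (auto simp: linear_form_add linear_form_scale field_simps eq_neg_iff_add_eq_0)
  hence "card U = (\<Sum>x\<in>U. card {c. l (x + c *s w) = 0})" by simp
  also have "\<dots> = CARD('a) * card {x\<in>U. l x = 0}"
    using assms(1,3) by (intro sum_card_translates) (auto simp: vec.subspace_def)
  finally show ?thesis .
qed

section \<open>The hermitian form\<close>

context square_field
begin

definition herm :: "'a ^ 'n \<Rightarrow> 'a ^ 'n \<Rightarrow> 'a" where
  "herm x y = (\<Sum>i\<in>UNIV. x $ i * (y $ i) ^ t)"

lemma herm_add_left: "herm (x + y) z = herm x z + herm y z"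
  and herm_add_right: "herm z (x + y) = herm z x + herm z y"
  and herm_diff_left: "herm (x - y) z = herm x z - herm y z"
  and herm_diff_right: "herm z (x - y) = herm z x - herm z y"
  and herm_scale_left: "herm (c *s x) z = c * herm x z"
  and herm_scale_right: "herm z (c *s x) = c ^ t * herm z x"
  and herm_0_left [simp]: "herm 0 z = 0"
  and herm_0_right [simp]: "herm z 0 = 0"
  by (simp_all add: herm_def algebra_simps frobenius_add frobenius_diff sum.distrib sum_subtractf
      sum_distrib_left power_mult_distrib)

lemmas herm_simps = herm_add_left herm_add_right herm_diff_left herm_diff_right
  herm_scale_left herm_scale_right

lemma herm_commute: "herm x y = herm y x ^ t"
  by (simp add: herm_def frobenius_sum power_mult_distrib power_t_power_t mult.commute)

lemma herm_eq_0_commute: "herm x y = 0 \<longleftrightarrow> herm y x = 0"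
  by (metis herm_commute zero_power_t)

lemma linear_form_herm: "linear_form (\<lambda>x. herm x a)"
  by (simp add: linear_form_def herm_simps)

text \<open>Every hyperplane thereby gets a pole \<open>a\<close>, and whether \<open>a\<close> is
  isotropic decides the type of its hermitian section.\<close>

lemma linear_form_eq_herm:
  assumes "linear_form (l :: 'a ^ 'n \<Rightarrow> 'a)"
  obtains a where "l = (\<lambda>x. herm x a)"
proof
  have "l x = herm x (\<chi> i. l (axis i 1) ^ t)" for x
  proof -
    have "l x = l (\<Sum>i\<in>UNIV. x $ i *s axis i 1)"
      by (simp add: basis_expansion)
    also have "\<dots> = (\<Sum>i\<in>UNIV. x $ i * l (axis i 1))"
      by (simp add: linear_form_sum[OF assms] linear_form_scale[OF assms])
    finally show ?thesis by (simp add: herm_def power_t_power_t)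
  qed
  thus "l = (\<lambda>x. herm x (\<chi> i. l (axis i 1) ^ t))" ..
qed

lemma herm_axis: "herm (axis i 1) a = (a $ i) ^ t"
proof -
  have "herm (axis i 1) a = (\<Sum>j\<in>UNIV. if j = i then (a $ i) ^ t else 0)"
    unfolding herm_def by (intro sum.cong) (auto simp: axis_def)
  thus ?thesis by simp
qed

lemma herm_nondegenerate:
  assumes "a \<noteq> 0"
  obtains w where "herm w a \<noteq> 0"
proof -
  obtain i where "a $ i \<noteq> 0" using assms by (auto simp: vec_eq_iff)
  with that[of "axis i 1"] show ?thesis by (simp add: herm_axis)
qed

lemma herm_translate:
  "herm (x + c *s a) (x + c *s a) = herm x x + (c ^ t * herm x a + c * herm a x) + c ^ (t + 1) * herm a a"
  by (simp add: herm_simps algebra_simps)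

text \<open>Each translate contains exactly one \<open>y\<close> orthogonal to \<open>a\<close>, and
  from there the form is \<open>h(y) + s ^ (t + 1) * h(a)\<close>: a norm equation with one solution
  if \<open>h(y) = 0\<close> and \<open>t + 1\<close> otherwise. The weight \<open>t\<close> merges
  both cases into one constant, so that summation does not depend on how often each occurs.\<close>

lemma card_isotropic_translates_aniso:
  assumes a: "herm a a \<noteq> 0"
  shows "card {c. herm (x + c *s a) (x + c *s a) = 0} +
         t * card {c. herm (x + c *s a) a = 0 \<and> herm (x + c *s a) (x + c *s a) = 0} = t + 1"
proof -
  define c0 where "c0 = - herm x a / herm a a"
  define y where "y = x + c0 *s a"
  have perp: "herm (x + c *s a) a = 0 \<longleftrightarrow> c = c0" for c
    using a by (simp add: herm_simps c0_def field_simps eq_neg_iff_add_eq_0)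
  hence ya: "herm y a = 0" by (simp add: y_def)
  hence ay: "herm a y = 0" by (simp add: herm_eq_0_commute)
  have trans: "herm (x + (s + c0) *s a) (x + (s + c0) *s a) = herm y y + s ^ (t + 1) * herm a a" for s
  proof -
    have "x + (s + c0) *s a = y + s *s a"
      by (simp add: y_def vector_sadd_rdistrib add_ac)
    thus ?thesis by (simp only: herm_translate ya ay) simp
  qed
  have "{c. herm (x + c *s a) (x + c *s a) = 0} = (\<lambda>s. s + c0) ` {s. s ^ (t + 1) = - herm y y / herm a a}"
  proof (intro equalityI subsetI)
    fix c assume "c \<in> {c. herm (x + c *s a) (x + c *s a) = 0}"
    with trans[of "c - c0"] a have "(c - c0) ^ (t + 1) = - herm y y / herm a a"
      by (simp add: field_simps eq_neg_iff_add_eq_0)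
    thus "c \<in> (\<lambda>s. s + c0) ` {s. s ^ (t + 1) = - herm y y / herm a a}"
      by (intro image_eqI[of _ _ "c - c0"]) auto
  qed (use a trans in \<open>auto simp: field_simps\<close>)
  hence c1: "card {c. herm (x + c *s a) (x + c *s a) = 0} = card {s. s ^ (t + 1) = - herm y y / herm a a}"
    by (simp add: card_image)
  have c2: "{c. herm (x + c *s a) a = 0 \<and> herm (x + c *s a) (x + c *s a) = 0} =
      (if herm y y = 0 then {c0} else {})"
    unfolding perp by (auto simp: y_def)
  show ?thesis
  proof (cases "herm y y = 0")
    case True
    have "{s::'a. s ^ (t + 1) = 0} = {0}" by auto
    with True show ?thesis unfolding c1 c2 by simp
  next
    case False
    \<comment> \<open>Values of the form on the diagonal lie in the fixed field, as
      \<open>card_norm_fibre\<close> requires.\<close>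
    have "(- herm y y / herm a a) ^ t = - herm y y / herm a a"
      by (simp add: power_divide frobenius_minus flip: herm_commute)
    with card_norm_fibre[of "- herm y y / herm a a"] False a show ?thesis
      unfolding c1 c2 by simp
  qed
qed

lemma card_isotropic_translates_aniso_le:
  "herm a a \<noteq> 0 \<Longrightarrow> card {c. herm (x + c *s a) (x + c *s a) = 0} \<le> t + 1"
  using card_isotropic_translates_aniso[of a x] by simp

text \<open>For isotropic \<open>a\<close> the norm term disappears and
  \<open>s = c * herm a x\<close> satisfies a trace equation.\<close>

lemma card_isotropic_translates_secant:
  assumes a: "herm a a = 0" "herm x a \<noteq> 0"
  shows "card {c. herm (x + c *s a) (x + c *s a) = 0} = t"
proof -
  have ax: "herm a x \<noteq> 0" using a by (simp add: herm_eq_0_commute)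
  have eq: "herm (x + c *s a) (x + c *s a) = 0 \<longleftrightarrow> (c * herm a x) ^ t + c * herm a x = - herm x x" for c
    by (simp add: herm_translate a power_mult_distrib add.commute eq_neg_iff_add_eq_0 flip: herm_commute)
  have "bij_betw (\<lambda>c. c * herm a x) {c. herm (x + c *s a) (x + c *s a) = 0} {s. s ^ t + s = - herm x x}"
    by (rule bij_betw_byWitness[where f' = "\<lambda>s. s / herm a x"]) (auto simp: eq ax)
  hence "card {c. herm (x + c *s a) (x + c *s a) = 0} = card {s. s ^ t + s = - herm x x}"
    by (rule bij_betw_same_card)
  also have "\<dots> = t"
    by (rule card_trace_fibre) (simp add: frobenius_minus flip: herm_commute)
  finally show ?thesis .
qed

text \<open>The weighted count summed over \<open>U\<close>. It is used in both directions: to build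
  up dimensions from hyperplanes, and to descend from a space to its section.\<close>

lemma card_section_aniso:
  assumes U: "vec.subspace U" "a \<in> U" and a: "herm a a \<noteq> 0"
  shows "card U = t\<^sup>2 * card {x\<in>U. herm x a = 0}"
    and "card {x\<in>U. herm x x = 0} + t * card {x\<in>U. herm x a = 0 \<and> herm x x = 0} =
      (t + 1) * card {x\<in>U. herm x a = 0}"
proof -
  show 1: "card U = t\<^sup>2 * card {x\<in>U. herm x a = 0}"
    using card_kernel[OF U(1) linear_form_herm U(2) a] by (simp add: card_field)
  have inv: "x + c *s a \<in> U" if "x \<in> U" for x c
    using U that by (auto simp: vec.subspace_def)
  have "t\<^sup>2 * (card {x\<in>U. herm x x = 0} + t * card {x\<in>U. herm x a = 0 \<and> herm x x = 0}) =
      (\<Sum>x\<in>U. card {c. herm (x + c *s a) (x + c *s a) = 0} +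
        t * card {c. herm (x + c *s a) a = 0 \<and> herm (x + c *s a) (x + c *s a) = 0})"
    unfolding sum.distrib sum_distrib_left[symmetric]
    using sum_card_translates[of U a "\<lambda>x. herm x x = 0"] inv
      sum_card_translates[of U a "\<lambda>x. herm x a = 0 \<and> herm x x = 0"]
    by (simp add: card_field algebra_simps)
  also have "\<dots> = (t + 1) * card U"
    using card_isotropic_translates_aniso[OF a] by simp
  also have "\<dots> = t\<^sup>2 * ((t + 1) * card {x\<in>U. herm x a = 0})"
    unfolding 1 by (simp add: algebra_simps)
  finally show "card {x\<in>U. herm x x = 0} + t * card {x\<in>U. herm x a = 0 \<and> herm x x = 0} =
      (t + 1) * card {x\<in>U. herm x a = 0}"
    using t_ge_2 by simp
qed

text \<open>Off the hyperplane orthogonal to \<open>a\<close>, exactly \<open>t\<close> of the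
  \<open>t^2\<close> vectors of each translate are isotropic, hence a fraction \<open>1 / t\<close>
  of the whole; multiplying by \<open>t\<close> avoids the division.\<close>

lemma card_section_tangent:
  assumes U: "vec.subspace U" "a \<in> U" and a: "herm a a = 0" and w: "w \<in> U" "herm w a \<noteq> 0"
  shows "card U = t\<^sup>2 * card {x\<in>U. herm x a = 0}"
    and "t * card {x\<in>U. herm x x = 0} + card {x\<in>U. herm x a = 0} =
      t * card {x\<in>U. herm x a = 0 \<and> herm x x = 0} + t\<^sup>2 * card {x\<in>U. herm x a = 0}"
proof -
  show 1: "card U = t\<^sup>2 * card {x\<in>U. herm x a = 0}"
    using card_kernel[OF U(1) linear_form_herm w] by (simp add: card_field)
  define S where "S = {x\<in>U. herm x a \<noteq> 0}"
  have "t\<^sup>2 * card {x\<in>S. herm x x = 0} = (\<Sum>x\<in>S. card {c. herm (x + c *s a) (x + c *s a) = 0})"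
    using U a by (subst sum_card_translates) (auto simp: S_def vec.subspace_def herm_simps card_field)
  also have "\<dots> = t * card S"
    using a by (simp add: card_isotropic_translates_secant S_def)
  finally have S: "t * card {x\<in>S. herm x x = 0} = card S"
    using t_ge_2 by (simp add: power2_eq_square)
  have "card U = card S + card {x\<in>U. herm x a = 0}"
    by (subst card_Un_disjoint[symmetric]) (auto simp: S_def intro!: arg_cong[where f = card])
  moreover have "card {x\<in>U. herm x x = 0} =
      card {x\<in>S. herm x x = 0} + card {x\<in>U. herm x a = 0 \<and> herm x x = 0}"
    by (subst card_Un_disjoint[symmetric]) (auto simp: S_def intro!: arg_cong[where f = card])
  ultimately show "t * card {x\<in>U. herm x x = 0} + card {x\<in>U. herm x a = 0} =
      t * card {x\<in>U. herm x a = 0 \<and> herm x x = 0} + t\<^sup>2 * card {x\<in>U. herm x a = 0}"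
    using S 1 by (simp add: algebra_simps)
qed

text \<open>Adding a coordinate adds an anisotropic axis vector, whose orthogonal complement is the
  previous space. So the counts satisfy \<open>N' = (t + 1) t^(2k) - t N\<close>, which explains the
  alternating sign; the factor \<open>t\<close> keeps the formula integral at
  \<open>k = 0\<close>.\<close>

lemma card_coordinate_isotropic:
  fixes I :: "'n::finite set"
  shows "card {x :: 'a ^ 'n. \<forall>i. i \<notin> I \<longrightarrow> x $ i = 0} = t ^ (2 * card I)"
    and "int t * int (card {x :: 'a ^ 'n. (\<forall>i. i \<notin> I \<longrightarrow> x $ i = 0) \<and> herm x x = 0}) =
      int t ^ (2 * card I) + (-1) ^ card I * (int t - 1) * int t ^ card I"
proof -
  have "finite I" by simp
  hence "card {x :: 'a ^ 'n. \<forall>i. i \<notin> I \<longrightarrow> x $ i = 0} = t ^ (2 * card I) \<and>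
    int t * int (card {x :: 'a ^ 'n. (\<forall>i. i \<notin> I \<longrightarrow> x $ i = 0) \<and> herm x x = 0}) =
      int t ^ (2 * card I) + (-1) ^ card I * (int t - 1) * int t ^ card I"
  proof (induction I rule: finite_induct)
    case empty
    have "{x :: 'a ^ 'n. \<forall>i. x $ i = 0} = {0}" "{x :: 'a ^ 'n. (\<forall>i. x $ i = 0) \<and> herm x x = 0} = {0}"
      by (auto simp: vec_eq_iff)
    thus ?case by simp
  next
    case (insert j I)
    define U where "U = {x :: 'a ^ 'n. \<forall>i. i \<notin> insert j I \<longrightarrow> x $ i = 0}"
    have U: "vec.subspace U" "axis j 1 \<in> U"
      by (auto simp: U_def vec.subspace_def axis_def)
    have perp: "herm x (axis j 1) = x $ j" for x :: "'a ^ 'n"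
      by (subst herm_commute) (simp add: herm_axis power_t_power_t)
    have aj: "herm (axis j 1) (axis j 1 :: 'a ^ 'n) \<noteq> 0" by (simp add: perp)
    have UI: "{x\<in>U. x $ j = 0} = {x :: 'a ^ 'n. \<forall>i. i \<notin> I \<longrightarrow> x $ i = 0}"
      using insert.hyps by (auto simp: U_def)
    have UI': "{x\<in>U. x $ j = 0 \<and> herm x x = 0} =
        {x :: 'a ^ 'n. (\<forall>i. i \<notin> I \<longrightarrow> x $ i = 0) \<and> herm x x = 0}"
      using UI by auto
    have U': "{x\<in>U. herm x x = 0} =
      {x :: 'a ^ 'n. (\<forall>i. i \<notin> insert j I \<longrightarrow> x $ i = 0) \<and> herm x x = 0}"
      by (auto simp: U_def)
    note sec = card_section_aniso[OF U aj, unfolded perp UI UI' U', unfolded U_def]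
    have "card {x :: 'a ^ 'n. (\<forall>i. i \<notin> insert j I \<longrightarrow> x $ i = 0) \<and> herm x x = 0} +
      t * card {x :: 'a ^ 'n. (\<forall>i. i \<notin> I \<longrightarrow> x $ i = 0) \<and> herm x x = 0} =
      (t + 1) * t ^ (2 * card I)"
      using sec(2) insert.IH by (simp only:)
    hence "int (card {x :: 'a ^ 'n. (\<forall>i. i \<notin> insert j I \<longrightarrow> x $ i = 0) \<and> herm x x = 0}) +
      int t * int (card {x :: 'a ^ 'n. (\<forall>i. i \<notin> I \<longrightarrow> x $ i = 0) \<and> herm x x = 0}) =
      (int t + 1) * int t ^ (2 * card I)"
      by (simp only: flip: of_nat_mult of_nat_add of_nat_power of_nat_Suc) (simp add: algebra_simps)
    hence "int t * int (card {x :: 'a ^ 'n. (\<forall>i. i \<notin> insert j I \<longrightarrow> x $ i = 0) \<and> herm x x = 0}) =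
      int t * ((int t + 1) * int t ^ (2 * card I)) -
      int t * (int t * int (card {x :: 'a ^ 'n. (\<forall>i. i \<notin> I \<longrightarrow> x $ i = 0) \<and> herm x x = 0}))"
      by (simp add: algebra_simps flip: distrib_left)
    note this[unfolded insert.IH[THEN conjunct2]]
    with insert.hyps insert.IH sec(1) show ?case
      by (auto simp add: algebra_simps power2_eq_square)
  qed
  thus "card {x :: 'a ^ 'n. \<forall>i. i \<notin> I \<longrightarrow> x $ i = 0} = t ^ (2 * card I)"
    and "int t * int (card {x :: 'a ^ 'n. (\<forall>i. i \<notin> I \<longrightarrow> x $ i = 0) \<and> herm x x = 0}) =
      int t ^ (2 * card I) + (-1) ^ card I * (int t - 1) * int t ^ card I"
    by blast+
qed

end

section \<open>Quadratic forms\<close>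

definition polar :: "('a::field ^ 'n \<Rightarrow> 'a) \<Rightarrow> 'a ^ 'n \<Rightarrow> 'a ^ 'n \<Rightarrow> 'a" where
  "polar f x y = f (x + y) - f x - f y"

text \<open>Polarization instead of a symmetric matrix keeps the notion correct in characteristic
  2.\<close>

definition quadratic_form :: "('a::field ^ 'n \<Rightarrow> 'a) \<Rightarrow> bool" where
  "quadratic_form f \<longleftrightarrow>
     (\<forall>c x. f (c *s x) = c\<^sup>2 * f x) \<and> (\<forall>y. linear_form (\<lambda>x. polar f x y))"

lemma polar_commute: "polar f x y = polar f y x"
  by (simp add: polar_def add.commute)

context
  fixes f :: "'a::field ^ 'n \<Rightarrow> 'a"
  assumes f: "quadratic_form f"
begin

lemma quadratic_scale: "f (c *s x) = c\<^sup>2 * f x"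
  using f by (simp add: quadratic_form_def)

lemma linear_form_polar: "linear_form (\<lambda>x. polar f x y)"
  using f by (simp add: quadratic_form_def)

lemma polar_add_left: "polar f (x + y) z = polar f x z + polar f y z"
  and polar_scale_left: "polar f (c *s x) z = c * polar f x z"
  and polar_diff_left: "polar f (x - y) z = polar f x z - polar f y z"
  using linear_form_add[OF linear_form_polar] linear_form_scale[OF linear_form_polar]
    linear_form_diff[OF linear_form_polar] by blast+

lemma polar_add_right: "polar f z (x + y) = polar f z x + polar f z y"
  and polar_scale_right: "polar f z (c *s x) = c * polar f z x"
  and polar_diff_right: "polar f z (x - y) = polar f z x - polar f z y"
  by (simp_all add: polar_commute[of f z] polar_add_left polar_scale_left polar_diff_left)

lemmas polar_simps = polar_add_left polar_scale_left polar_diff_left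
  polar_add_right polar_scale_right polar_diff_right

lemma quadratic_add: "f (x + y) = f x + f y + polar f x y"
  by (simp add: polar_def)

lemma quadratic_translate: "f (x + c *s y) = f x + c * polar f x y + c\<^sup>2 * f y"
  by (simp add: quadratic_add quadratic_scale polar_simps)

lemma polar_self: "polar f x x = 2 * f x"
proof -
  have "x + x = 2 *s x" by (simp add: vec_eq_iff)
  thus ?thesis by (simp add: polar_def quadratic_scale power2_eq_square algebra_simps)
qed

lemma quadratic_vanishing_on_hyperplane:
  assumes l: "linear_form l" "l w \<noteq> 0" and van: "\<And>x. l x = 0 \<Longrightarrow> f x = 0"
  obtains l' where "linear_form l'" "f = (\<lambda>x. l x * l' x)"
proof
  define v where "v = inverse (l w) *s w"
  have lv: "l v = 1" using l by (simp add: v_def linear_form_scale)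
  \<comment> \<open>Writing \<open>x = y + l x *s v\<close> with \<open>l y = 0\<close> gives
    \<open>f x = l x * polar f y v + (l x)^2 * f v\<close>; expressing \<open>polar f y v\<close>
    through \<open>x\<close> leaves this cofactor.\<close>
  define l' where "l' x = polar f x v - l x * f v" for x
  show "linear_form l'"
    using linear_form_polar[of v] l(1) by (simp add: linear_form_def l'_def algebra_simps)
  show "f = (\<lambda>x. l x * l' x)"
  proof
    fix x
    define y where "y = x - l x *s v"
    have x: "x = y + l x *s v" by (simp add: y_def)
    have "l y = 0"
      by (simp add: y_def lv linear_form_diff[OF l(1)] linear_form_scale[OF l(1)])
    hence fy: "f y = 0" by (rule van)
    have "polar f y v = polar f x v - 2 * l x * f v"
      by (simp add: y_def polar_diff_left polar_scale_left polar_self)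
    with quadratic_translate[of y "l x" v] fy
    have "f x = l x * (polar f x v - 2 * l x * f v) + (l x)\<^sup>2 * f v"
      by (simp only: flip: x) simp
    thus "f x = l x * l' x"
      by (simp add: l'_def algebra_simps power2_eq_square)
  qed
qed

end

text \<open>Along any translate in direction \<open>w\<close>, \<open>f\<close> is a polynomial with
  leading coefficient \<open>f w\<close>, so of degree exactly 2.\<close>

lemma card_quadratic_zeros_le:
  fixes f :: "'a::{field,finite} ^ 'n \<Rightarrow> 'a"
  assumes f: "quadratic_form f" and "vec.subspace U" "w \<in> U" "f w \<noteq> 0"
  shows "CARD('a) * card {x\<in>U. f x = 0} \<le> 2 * card U"
proof -
  have "CARD('a) * card {x\<in>U. f x = 0} = (\<Sum>x\<in>U. card {c. f (x + c *s w) = 0})"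
    using assms by (intro sum_card_translates[symmetric]) (auto simp: vec.subspace_def)
  also have "\<dots> \<le> (\<Sum>x\<in>U. 2)"
  proof (rule sum_mono)
    fix x
    have "{c. f (x + c *s w) = 0} = {c. f w * c\<^sup>2 + polar f x w * c + f x = 0}"
      by (simp add: quadratic_translate[OF f] algebra_simps)
    with card_roots_quadratic[of "f w"] show "card {c. f (x + c *s w) = 0} \<le> 2"
      using assms by simp
  qed
  finally show ?thesis by simp
qed

context square_field
begin

lemma power_t_le: "n = Suc k \<Longrightarrow> 2 * int t ^ k \<le> int t ^ n"
  using t_ge_2 by simp

text \<open>With the powers of \<open>t\<close> as independent atoms, these inequalities make the
  comparisons with \<open>section_bound\<close> linear.\<close>

lemma power_t_bounds:
  "2 * int t ^ 2 \<le> int t ^ 3" "2 * int t ^ 3 \<le> int t ^ 4" "2 * int t ^ 4 \<le> int t ^ 5"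
  "2 * int t ^ 5 \<le> int t ^ 6" "2 * int t ^ 6 \<le> int t ^ 7" "4 \<le> int t ^ 2"
proof -
  show "4 \<le> int t ^ 2" using power_mono[of 2 "int t" 2] t_ge_2 by simp
qed (rule power_t_le; simp)+

lemma square_t_cancel: "t\<^sup>2 * m = t\<^sup>2 * n \<longleftrightarrow> m = n"
  using t_ge_2 by simp

lemma square_t_le_cancel: "t\<^sup>2 * m \<le> t\<^sup>2 * n \<longleftrightarrow> m \<le> n"
  using t_ge_2 by simp

lemmas of_nat_hom = of_nat_add of_nat_mult of_nat_power of_nat_1 of_nat_numeral

section \<open>Hyperplane and plane sections of the hermitian variety\<close>

lemma card_vectors: "CARD('a ^ 5) = t ^ 10"
  by (simp add: card_field power_mult[symmetric])

lemma card_isotropic_5: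
  "int (card {x :: 'a ^ 5. herm x x = 0}) = int t ^ 9 - int t ^ 5 + int t ^ 4"
proof -
  have "int t * int (card {x :: 'a ^ 5. herm x x = 0}) = int t ^ 10 + (-1) * (int t - 1) * int t ^ 5"
    using card_coordinate_isotropic(2)[of "UNIV :: 5 set"] by simp
  hence "int t * int (card {x :: 'a ^ 5. herm x x = 0}) = int t * (int t ^ 9 - int t ^ 5 + int t ^ 4)"
    by algebra
  thus ?thesis using t_ge_2 by simp
qed

lemma card_hyperplane:
  assumes "linear_form (l :: 'a ^ 5 \<Rightarrow> 'a)" "l w \<noteq> 0"
  shows "card {x. l x = 0} = t ^ 8"
proof -
  have "t ^ 10 = t\<^sup>2 * card {x. l x = 0}"
    using card_kernel[of UNIV l w] assms card_vectors by (simp add: card_field)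
  hence "t\<^sup>2 * card {x. l x = 0} = t\<^sup>2 * t ^ 8" by (simp flip: power_add)
  thus ?thesis by (simp only: square_t_cancel)
qed

lemma card_hermitian_hyperplane:
  assumes "(a :: 'a ^ 5) \<noteq> 0"
  shows "card {x. herm x a = 0} = t ^ 8"
  using herm_nondegenerate[OF assms] card_hyperplane[OF linear_form_herm] by blast

lemma card_isotropic_hyperplane_aniso:
  assumes "herm a (a :: 'a ^ 5) \<noteq> 0"
  shows "int (card {x. herm x a = 0 \<and> herm x x = 0}) = int t ^ 7 + int t ^ 4 - int t ^ 3"
proof -
  have "a \<noteq> 0" using assms by auto
  have "card {x :: 'a ^ 5. herm x x = 0} + t * card {x. herm x a = 0 \<and> herm x x = 0} = (t + 1) * t ^ 8"
    using card_section_aniso(2)[of UNIV a] assms card_hermitian_hyperplane[OF \<open>a \<noteq> 0\<close>] by simp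
  from arg_cong[OF this, of int]
  have "int (card {x :: 'a ^ 5. herm x x = 0}) + int t * int (card {x. herm x a = 0 \<and> herm x x = 0}) = (int t + 1) * int t ^ 8"
    by (simp only: of_nat_hom)
  hence "int t * int (card {x. herm x a = 0 \<and> herm x x = 0}) = int t * (int t ^ 7 + int t ^ 4 - int t ^ 3)"
    unfolding card_isotropic_5 by algebra
  thus ?thesis using t_ge_2 by simp
qed

lemma card_isotropic_hyperplane_tangent:
  assumes "herm a (a :: 'a ^ 5) = 0" "a \<noteq> 0"
  shows "int (card {x. herm x a = 0 \<and> herm x x = 0}) = int t ^ 7 - int t ^ 5 + int t ^ 4"
proof -
  obtain w where w: "herm w a \<noteq> 0" using herm_nondegenerate[OF assms(2)] .
  have "t * card {x :: 'a ^ 5. herm x x = 0} + t ^ 8 = t * card {x. herm x a = 0 \<and> herm x x = 0} + t\<^sup>2 * t ^ 8"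
    using card_section_tangent(2)[of UNIV a w] assms w card_hermitian_hyperplane[of a] by simp
  from arg_cong[OF this, of int]
  have "int t * int (card {x :: 'a ^ 5. herm x x = 0}) + int t ^ 8 =
      int t * int (card {x. herm x a = 0 \<and> herm x x = 0}) + int t ^ 2 * int t ^ 8"
    by (simp only: of_nat_hom)
  hence "int t * int (card {x. herm x a = 0 \<and> herm x x = 0}) = int t * (int t ^ 7 - int t ^ 5 + int t ^ 4)"
    unfolding card_isotropic_5 by algebra
  thus ?thesis using t_ge_2 by simp
qed

lemma card_isotropic_hyperplane_le:
  assumes "(a :: 'a ^ 5) \<noteq> 0"
  shows "int (card {x. herm x a = 0 \<and> herm x x = 0}) \<le> int t ^ 7 + int t ^ 4 - int t ^ 3"
  using card_isotropic_hyperplane_aniso[of a] card_isotropic_hyperplane_tangent[of a] assms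
    power_t_bounds by (cases "herm a a = 0") auto

text \<open>Inclusion-exclusion for two hyperplanes needs their intersection from below. On the
  complement of \<open>a\<close>, \<open>b\<close> acts like its projection \<open>pr b\<close>, so
  the section lemmas apply inside that complement; the minimum belongs to anisotropic
  \<open>pr b\<close>.\<close>

lemma card_isotropic_plane_ge:
  assumes a: "herm a (a :: 'a ^ 5) \<noteq> 0"
  shows "int t ^ 5 - int t ^ 3 + int t ^ 2 \<le> int (card {x. herm x a = 0 \<and> herm x b = 0 \<and> herm x x = 0})"
    (is "_ \<le> int (card ?P)")
proof -
  define U where "U = {x. herm x a = 0}"
  define pr where "pr x = x - (herm x a / herm a a) *s a" for x
  have "a \<noteq> 0" using a by auto
  have U: "vec.subspace U"
    using subspace_kernel[OF vec.subspace_UNIV linear_form_herm] by (simp add: U_def)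
  have prU: "pr x \<in> U" for x
    using a by (simp add: U_def pr_def herm_simps)
  have H: "herm x (pr b) = herm x b" if "x \<in> U" for x
    using that by (simp add: U_def pr_def herm_simps)
  have P: "?P = {x\<in>U. herm x (pr b) = 0 \<and> herm x x = 0}"
    using H by (auto simp: U_def)
  have cU: "card U = t ^ 8"
    using card_hermitian_hyperplane[OF \<open>a \<noteq> 0\<close>] by (simp add: U_def)
  have iU: "int (card {x\<in>U. herm x x = 0}) = int t ^ 7 + int t ^ 4 - int t ^ 3"
    using card_isotropic_hyperplane_aniso[OF a] by (simp add: U_def)
  have cP: "card {x\<in>U. herm x (pr b) = 0} = t ^ 6"
    if "card U = t\<^sup>2 * card {x\<in>U. herm x (pr b) = 0}"
  proof -
    have "t\<^sup>2 * card {x\<in>U. herm x (pr b) = 0} = t\<^sup>2 * t ^ 6"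
      unfolding that[symmetric] cU by (simp flip: power_add)
    thus ?thesis by (simp only: square_t_cancel)
  qed
  consider "pr b = 0" | "herm (pr b) (pr b) \<noteq> 0" | "pr b \<noteq> 0" "herm (pr b) (pr b) = 0" by blast
  thus ?thesis
  proof cases
    case 1
    hence "int (card ?P) = int t ^ 7 + int t ^ 4 - int t ^ 3" using iU by (simp add: P)
    with power_t_bounds show ?thesis by linarith
  next
    case 2
    note sec = card_section_aniso[OF U prU 2]
    have "int (card {x\<in>U. herm x x = 0}) + int t * int (card ?P) = (int t + 1) * int t ^ 6"
      using arg_cong[OF sec(2), of int] unfolding cP[OF sec(1)] P by (simp only: of_nat_hom)
    hence "int t * int (card ?P) = int t * (int t ^ 5 - int t ^ 3 + int t ^ 2)"
      unfolding iU by algebra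
    thus ?thesis using t_ge_2 by simp
  next
    case 3
    obtain w where w: "herm w (pr b) \<noteq> 0" using herm_nondegenerate[OF 3(1)] .
    \<comment> \<open>The vector witnessing tangency must lie in \<open>U\<close>; projecting
      \<open>w\<close> does not change its product with \<open>pr b\<close>, which is orthogonal to
      \<open>a\<close>.\<close>
    have "herm a (pr b) = 0" using prU[of b] by (simp add: U_def herm_eq_0_commute)
    hence w': "herm (pr w) (pr b) \<noteq> 0" using w by (simp add: pr_def[of w] herm_simps)
    note sec = card_section_tangent[OF U prU 3(2) prU w']
    have "int t * int (card {x\<in>U. herm x x = 0}) + int t ^ 6 = int t * int (card ?P) + int t ^ 2 * int t ^ 6"
      using arg_cong[OF sec(2), of int] unfolding cP[OF sec(1)] P by (simp only: of_nat_hom)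
    hence "int t * int (card ?P) = int t * (int t ^ 5 + int t ^ 4 - int t ^ 3)"
      unfolding iU by algebra
    hence "int (card ?P) = int t ^ 5 + int t ^ 4 - int t ^ 3" using t_ge_2 by simp
    with power_t_bounds show ?thesis by linarith
  qed
qed

text \<open>\<open>1 + (t\<^sup>2 - 1) (2 t\<^sup>5 + t\<^sup>3 + 2 t\<^sup>2 + 1)\<close>: the affine count corresponding to
  \<open>n - d\<close> projective points.\<close>

definition section_bound :: int where
  "section_bound = 2 * int t ^ 7 - int t ^ 5 + 2 * int t ^ 4 - int t ^ 3 - int t ^ 2"

text \<open>If one pole is anisotropic, twice the largest hyperplane section minus the smallest
  plane section is exactly \<open>section_bound\<close>. If both are isotropic, the hyperplane
  sections are so small that their sum suffices.\<close>

lemma card_two_hyperplanes_le: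
  assumes "(a :: 'a ^ 5) \<noteq> 0" "b \<noteq> 0"
  shows "int (card {x. (herm x a = 0 \<or> herm x b = 0) \<and> herm x x = 0}) \<le> section_bound"
    (is "?N \<le> _")
proof -
  let ?Na = "int (card {x. herm x a = 0 \<and> herm x x = 0})"
  let ?Nb = "int (card {x. herm x b = 0 \<and> herm x x = 0})"
  have "int (card {x. (herm x a = 0 \<or> herm x b = 0) \<and> herm x x = 0}) +
      int (card {x. herm x a = 0 \<and> herm x b = 0 \<and> herm x x = 0}) =
      int (card {x. herm x a = 0 \<and> herm x x = 0}) + int (card {x. herm x b = 0 \<and> herm x x = 0})"
  proof -
    have "{x. herm x a = 0 \<and> herm x x = 0} \<union> {x. herm x b = 0 \<and> herm x x = 0} =
        {x. (herm x a = 0 \<or> herm x b = 0) \<and> herm x x = 0}"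
      "{x. herm x a = 0 \<and> herm x x = 0} \<inter> {x. herm x b = 0 \<and> herm x x = 0} =
        {x. herm x a = 0 \<and> herm x b = 0 \<and> herm x x = 0}" by auto
    with card_Un_Int[of "{x. herm x a = 0 \<and> herm x x = 0}" "{x. herm x b = 0 \<and> herm x x = 0}"]
    show ?thesis by simp
  qed
  moreover have "{x. herm x b = 0 \<and> herm x a = 0 \<and> herm x x = 0} = {x. herm x a = 0 \<and> herm x b = 0 \<and> herm x x = 0}"
    by auto
  ultimately have eqs:
    "?N + int (card {x. herm x a = 0 \<and> herm x b = 0 \<and> herm x x = 0}) = ?Na + ?Nb"
    "?N + int (card {x. herm x b = 0 \<and> herm x a = 0 \<and> herm x x = 0}) = ?Na + ?Nb"
    by simp_all
  have le: "?Na \<le> int t ^ 7 + int t ^ 4 - int t ^ 3" "?Nb \<le> int t ^ 7 + int t ^ 4 - int t ^ 3"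
    using card_isotropic_hyperplane_le assms by blast+
  consider "herm a a \<noteq> 0" | "herm b b \<noteq> 0" | "herm a a = 0" "herm b b = 0" by blast
  thus ?thesis
  proof cases
    case 1
    from card_isotropic_plane_ge[OF this, of b] eqs le show ?thesis
      unfolding section_bound_def by linarith
  next
    case 2
    from card_isotropic_plane_ge[OF this, of a] eqs le show ?thesis
      unfolding section_bound_def by linarith
  next
    case 3
    from card_isotropic_hyperplane_tangent[OF 3(1) assms(1)]
      card_isotropic_hyperplane_tangent[OF 3(2) assms(2)] eqs power_t_bounds show ?thesis
      unfolding section_bound_def by linarith
  qed
qed

lemma section_bound_reducible:
  assumes f: "quadratic_form (f :: 'a ^ 5 \<Rightarrow> 'a)" "f z \<noteq> 0"
    and l: "linear_form l" "l w \<noteq> 0" "\<And>x. l x = 0 \<Longrightarrow> f x = 0"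
  shows "int (card {x. f x = 0 \<and> herm x x = 0}) \<le> section_bound"
proof -
  obtain l' where l': "linear_form l'" "f = (\<lambda>x. l x * l' x)"
    by (rule quadratic_vanishing_on_hyperplane[OF f(1) l])
  obtain a where a: "l = (\<lambda>x. herm x a)" using linear_form_eq_herm[OF l(1)] .
  obtain b where b: "l' = (\<lambda>x. herm x b)" using linear_form_eq_herm[OF l'(1)] .
  note ab = a b
  have "a \<noteq> 0" "b \<noteq> 0" using f(2) unfolding l'(2) ab by auto
  from card_two_hyperplanes_le[OF this] show ?thesis
    unfolding l'(2) ab by simp
qed

section \<open>Irreducible quadrics with a singular point\<close>

text \<open>Translates in the direction of a nonsingular zero \<open>P\<close> meet the quadric once
  off the tangent hyperplane; that hyperplane is not contained in the quadric and contributes at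
  most \<open>2 t^6\<close>. Together this is \<open>(t^8 - t^6) + 2 t^6\<close>.\<close>

lemma card_zeros_le:
  assumes f: "quadratic_form (f :: 'a ^ 5 \<Rightarrow> 'a)"
    and irr: "\<And>l w. linear_form l \<Longrightarrow> l w \<noteq> 0 \<Longrightarrow> \<exists>x. l x = 0 \<and> f x \<noteq> 0"
  shows "card {x. f x = 0} \<le> t ^ 8 + t ^ 6"
proof (cases "\<exists>P w. f P = 0 \<and> polar f w P \<noteq> 0")
  case True
  then obtain P w where P: "f P = 0" "polar f w P \<noteq> 0" by blast
  let ?l = "\<lambda>x. polar f x P"
  note lin = linear_form_polar[OF f, of P]
  have PP: "polar f P P = 0" using P by (simp add: polar_self[OF f])
  define S where "S = {x. ?l x \<noteq> 0}"
  have "t\<^sup>2 * card {x\<in>S. f x = 0} = (\<Sum>x\<in>S. card {c. f (x + c *s P) = 0})"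
    using PP by (subst sum_card_translates) (auto simp: S_def card_field polar_simps[OF f])
  also have "\<dots> = (\<Sum>x\<in>S. 1)"
  proof (rule sum.cong)
    fix x assume "x \<in> S"
    hence "{c. f (x + c *s P) = 0} = {- f x / ?l x}"
      using P(1) by (auto simp: S_def quadratic_translate[OF f] field_simps eq_neg_iff_add_eq_0)
    thus "card {c. f (x + c *s P) = 0} = 1" by simp
  qed simp
  finally have "t\<^sup>2 * card {x\<in>S. f x = 0} = card S" by simp
  moreover have "S = UNIV - {x. ?l x = 0}" by (auto simp: S_def)
  hence "card S = t ^ 10 - t ^ 8"
    using card_hyperplane[OF lin P(2)] by (simp only: card_Diff_subset finite subset_UNIV card_vectors)
  ultimately have 1: "t\<^sup>2 * card {x\<in>S. f x = 0} = t ^ 10 - t ^ 8" by simp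
  obtain z where z: "?l z = 0" "f z \<noteq> 0" using irr[OF lin P(2)] by blast
  have "vec.subspace {x. ?l x = 0}"
    using subspace_kernel[OF vec.subspace_UNIV lin] by simp
  from card_quadratic_zeros_le[OF f this, of z] z
  have 2: "t\<^sup>2 * card {x. ?l x = 0 \<and> f x = 0} \<le> 2 * t ^ 8"
    by (simp add: card_field card_hyperplane[OF lin P(2)])
  have "card {x. f x = 0} = card {x\<in>S. f x = 0} + card {x. ?l x = 0 \<and> f x = 0}"
    by (subst card_Un_disjoint[symmetric]) (auto simp: S_def intro!: arg_cong[where f = card])
  moreover have "t ^ 8 \<le> t ^ 10" using t_ge_2 by (intro power_increasing) auto
  ultimately have "t\<^sup>2 * card {x. f x = 0} \<le> t ^ 10 + t ^ 8"
    using 1 2 by (simp add: distrib_left)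
  also have "\<dots> = t\<^sup>2 * (t ^ 8 + t ^ 6)" by (simp add: algebra_simps flip: power_add)
  finally show ?thesis using t_ge_2 by simp
next
  case False
  have "linear_form (\<lambda>x. x $ 0)" "(1 :: 'a ^ 5) $ 0 \<noteq> 0" by (auto simp: linear_form_def)
  then obtain w where w: "f w \<noteq> 0" using irr[of "\<lambda>x. x $ 0" 1] by blast
  have "t\<^sup>2 * card {x. f x = 0} = (\<Sum>x\<in>UNIV. card {c. f (x + c *s w) = 0})"
    using sum_card_translates[of UNIV w "\<lambda>x. f x = 0"] by (simp add: card_field)
  also have "\<dots> \<le> (\<Sum>x\<in>(UNIV :: ('a ^ 5) set). 1)"
  proof (rule sum_mono)
    fix x
    \<comment> \<open>Every zero is now orthogonal to everything, so starting from a zero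
      \<open>y\<close> the form along \<open>w\<close> is \<open>(d - c)^2 * f w\<close>.\<close>
    have "c = d" if c: "f (x + c *s w) = 0" and d: "f (x + d *s w) = 0" for c d
    proof -
      define y where "y = x + c *s w"
      have "polar f y w = 0" using c False by (simp add: y_def polar_commute[of f _ w])
      have "x + d *s w = y + (d - c) *s w"
        by (simp add: y_def vec.scale_left_diff_distrib)
      hence "f (x + d *s w) = (d - c)\<^sup>2 * f w"
        using c \<open>polar f y w = 0\<close> by (simp only: quadratic_translate[OF f, of y]) (simp add: y_def)
      thus "c = d" using d w by simp
    qed
    thus "card {c. f (x + c *s w) = 0} \<le> 1"
      by (auto simp: card_le_Suc0_iff_eq)
  qed
  also have "\<dots> = t\<^sup>2 * t ^ 8" by (simp add: card_vectors del: CARD_vec flip: power_add)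
  finally have "card {x. f x = 0} \<le> t ^ 8" by (simp only: square_t_le_cancel)
  thus ?thesis by simp
qed

text \<open>The zero set of \<open>f\<close> is invariant under translation by \<open>V\<close>. For
  anisotropic \<open>V\<close> each translate has at most \<open>t + 1\<close> isotropic vectors; at
  \<open>t = 2\<close> the resulting bound is 240 against 244. For isotropic \<open>V\<close> the
  trivial bound \<open>t^2\<close> is used only on the hyperplane orthogonal to \<open>V\<close>,
  where \<open>f\<close> has at most \<open>2 t^6\<close> zeros.\<close>

lemma section_bound_singular:
  assumes f: "quadratic_form (f :: 'a ^ 5 \<Rightarrow> 'a)"
    and irr: "\<And>l w. linear_form l \<Longrightarrow> l w \<noteq> 0 \<Longrightarrow> \<exists>x. l x = 0 \<and> f x \<noteq> 0"
    and V: "V \<noteq> 0" "f V = 0" "\<And>x. polar f x V = 0"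
  shows "int (card {x. f x = 0 \<and> herm x x = 0}) \<le> section_bound"
proof -
  define Z where "Z = {x. f x = 0}"
  define A where "A = {x\<in>Z. herm x x = 0}"
  have inv: "x + c *s V \<in> Z" if "x \<in> Z" for x c
    using that V by (simp add: Z_def quadratic_translate[OF f])
  have sum: "t\<^sup>2 * card A = (\<Sum>x\<in>Z. card {c. herm (x + c *s V) (x + c *s V) = 0})"
    using sum_card_translates[of Z V "\<lambda>x. herm x x = 0", OF inv] by (simp add: card_field A_def)
  have cZ: "int (card Z) \<le> int t ^ 8 + int t ^ 6"
    using card_zeros_le[OF f irr, THEN of_nat_mono[where 'a = int]] by (simp only: of_nat_hom Z_def)
  have "int (card A) \<le> section_bound"
  proof (cases "herm V V = 0")
    case False
    have "t\<^sup>2 * card A \<le> (\<Sum>x\<in>Z. t + 1)"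
      unfolding sum using False by (intro sum_mono card_isotropic_translates_aniso_le)
    hence "t\<^sup>2 * card A \<le> (t + 1) * card Z" by (simp add: mult.commute)
    from of_nat_mono[OF this, where 'a = int]
    have "int t ^ 2 * int (card A) \<le> (int t + 1) * int (card Z)"
      by (simp only: of_nat_hom)
    also have "\<dots> \<le> (int t + 1) * (int t ^ 8 + int t ^ 6)"
      using cZ by (intro mult_left_mono) auto
    also have "\<dots> = int t ^ 2 * (int t ^ 7 + int t ^ 6 + int t ^ 5 + int t ^ 4)" by algebra
    finally have "int (card A) \<le> int t ^ 7 + int t ^ 6 + int t ^ 5 + int t ^ 4"
      using t_ge_2 by simp
    with power_t_bounds show ?thesis unfolding section_bound_def by linarith
  next
    case True
    define K where "K = {x\<in>Z. herm x V = 0}"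
    obtain w where w: "herm w V \<noteq> 0" using herm_nondegenerate[OF V(1)] .
    obtain z where z: "herm z V = 0" "f z \<noteq> 0" using irr[OF linear_form_herm w] by blast
    have "vec.subspace {x. herm x V = 0}"
      using subspace_kernel[OF vec.subspace_UNIV linear_form_herm] by simp
    from card_quadratic_zeros_le[OF f this, of z] z
    have "t\<^sup>2 * card {x. herm x V = 0 \<and> f x = 0} \<le> 2 * t ^ 8"
      by (simp add: card_field card_hermitian_hyperplane[OF V(1)])
    also have "\<dots> = t\<^sup>2 * (2 * t ^ 6)" by (simp flip: power_add)
    also have "{x. herm x V = 0 \<and> f x = 0} = K" by (auto simp: K_def Z_def)
    finally have "card K \<le> 2 * t ^ 6" using t_ge_2 by simp
    from of_nat_mono[OF this, where 'a = int]
    have cK: "int (card K) \<le> 2 * int t ^ 6" by (simp only: of_nat_hom)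
    have "t\<^sup>2 * card A \<le> (\<Sum>x\<in>Z. if x \<in> K then t\<^sup>2 else t)"
      unfolding sum
    proof (rule sum_mono)
      fix x assume "x \<in> Z"
      have "card {c. herm (x + c *s V) (x + c *s V) = 0} \<le> CARD('a)" by (intro card_mono) auto
      thus "card {c. herm (x + c *s V) (x + c *s V) = 0} \<le> (if x \<in> K then t\<^sup>2 else t)"
        using card_isotropic_translates_secant[OF True, of x] \<open>x \<in> Z\<close>
        by (auto simp: K_def card_field)
    qed
    also have "\<dots> = t\<^sup>2 * card K + t * card (Z - K)"
      using sum.subset_diff[of K Z "\<lambda>x. if x \<in> K then t\<^sup>2 else t"] by (simp add: K_def)
    finally have "t\<^sup>2 * card A \<le> t\<^sup>2 * card K + t * card (Z - K)" .
    moreover have "card Z = card (Z - K) + card K"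
      by (subst card_Un_disjoint[symmetric]) (auto simp: K_def intro!: arg_cong[where f = card])
    ultimately have "int (t\<^sup>2 * card A) \<le> int (t\<^sup>2 * card K + t * card (Z - K))" "int (card Z) = int (card (Z - K)) + int (card K)"
      by (simp_all only: of_nat_le_iff of_nat_add)
    hence "int t ^ 2 * int (card A) \<le> int t * int (card Z) + (int t ^ 2 - int t) * int (card K)"
      by (simp add: algebra_simps)
    also have "\<dots> \<le> int t * (int t ^ 8 + int t ^ 6) + (int t ^ 2 - int t) * (2 * int t ^ 6)"
      using cZ cK t_ge_2 by (intro add_mono mult_left_mono) (auto simp: power2_eq_square)
    also have "\<dots> = int t ^ 2 * (int t ^ 7 + 2 * int t ^ 6 - int t ^ 5)" by algebra
    finally have "int (card A) \<le> int t ^ 7 + 2 * int t ^ 6 - int t ^ 5"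
      using t_ge_2 by simp
    with power_t_bounds show ?thesis unfolding section_bound_def by linarith
  qed
  thus ?thesis by (simp add: A_def Z_def)
qed

end

section \<open>Nonsingular quadrics\<close>

lemma card_kernel_ge:
  fixes l :: "'a::{field,finite} ^ 'n \<Rightarrow> 'a"
  assumes "vec.subspace U" "linear_form l"
  shows "card U \<le> CARD('a) * card {x\<in>U. l x = 0}"
proof (cases "\<exists>w\<in>U. l w \<noteq> 0")
  case True
  with card_kernel[OF assms] show ?thesis by auto
next
  case False
  hence "{x\<in>U. l x = 0} = U" by auto
  thus ?thesis by simp
qed

text \<open>Fibres of squaring have at most two elements; the strict inequality comes from the fibre
  over 0, which has one.\<close>

lemma card_squares:
  "CARD('a) < 2 * card (range (\<lambda>x :: 'a::{field,finite}. x\<^sup>2))"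
proof -
  let ?Q = "range (\<lambda>x :: 'a. x\<^sup>2)"
  have le: "card {x :: 'a. x\<^sup>2 = c} \<le> 2" for c
    by (rule card_roots_binomial) simp
  have "CARD('a) = (\<Sum>c\<in>?Q. card {x. x\<^sup>2 = c})"
    using sum.group[of UNIV ?Q "\<lambda>x. x\<^sup>2" "\<lambda>_. 1 :: nat"] by simp
  also have "\<dots> < (\<Sum>c\<in>?Q. 2)"
  proof (rule sum_strict_mono_ex1)
    have "{x :: 'a. x\<^sup>2 = 0} = {0}" by auto
    thus "\<exists>c\<in>?Q. card {x. x\<^sup>2 = c} < 2" by (intro bexI[of _ 0] image_eqI[of _ _ 0]) auto
  qed (auto simp: le)
  finally show ?thesis by simp
qed

text \<open>The values \<open>a * s\<close> and \<open>c - b * s\<close> over squares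
  \<open>s\<close> each fill more than half of the field, so they meet.\<close>

lemma exists_diagonal_value:
  fixes a b c :: "'a::{field,finite}"
  assumes "a \<noteq> 0" "b \<noteq> 0"
  obtains x y where "a * x\<^sup>2 + b * y\<^sup>2 = c"
proof -
  let ?Q = "range (\<lambda>x :: 'a. x\<^sup>2)"
  have "\<exists>s\<in>?Q. \<exists>s'\<in>?Q. a * s = c - b * s'"
  proof (rule ccontr)
    assume "\<not> ?thesis"
    hence "(\<lambda>s. a * s) ` ?Q \<inter> (\<lambda>s. c - b * s) ` ?Q = {}" by auto
    hence "card ((\<lambda>s. a * s) ` ?Q \<union> (\<lambda>s. c - b * s) ` ?Q) =
        card ((\<lambda>s. a * s) ` ?Q) + card ((\<lambda>s. c - b * s) ` ?Q)"
      by (intro card_Un_disjoint) auto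
    also have "\<dots> = 2 * card ?Q"
      using assms by (subst (1 2) card_image) (auto simp: inj_on_def)
    finally have "2 * card ?Q \<le> CARD('a)"
      using card_mono[OF finite subset_UNIV] by metis
    with card_squares[where 'a = 'a] show False by simp
  qed
  with that show ?thesis by (auto simp: algebra_simps)
qed

text \<open>The instance of Chevalley's theorem needed to split off a second hyperbolic pair.
  Dimension is measured by cardinality, and assuming anisotropy makes every nonzero vector of
  \<open>U\<close> usable for an orthogonal system.\<close>

lemma ternary_quadratic_isotropic:
  fixes f :: "'a::{field,finite} ^ 'n \<Rightarrow> 'a"
  assumes f: "quadratic_form f" and U: "vec.subspace U" and card: "card U = CARD('a) ^ 3"
  obtains x where "x \<in> U" "x \<noteq> 0" "f x = 0"
proof (rule ccontr)
  assume "\<not> thesis"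
  with that have aniso: "x = 0" if "x \<in> U" "f x = 0" for x using that by blast
  have q: "CARD('a) > 1"
    using card_mono[of UNIV "{0, 1 :: 'a}"] by simp
  have exists: "\<exists>x\<in>A. x \<notin> B" if "card B < card A" for A B :: "('a ^ 'n) set"
    using that card_mono[of B A] by (meson finite not_less subsetI)
  have cv: "card {0 :: 'a ^ 'n} < card U" using one_less_power[OF q, of 3] card by simp
  then obtain v where v: "v \<in> U" "v \<noteq> 0" using exists[OF cv] by auto
  hence fv: "f v \<noteq> 0" using aniso by blast
  define T where "T = {x\<in>U. polar f x v = 0}"
  have T: "vec.subspace T" unfolding T_def by (rule subspace_kernel[OF U linear_form_polar[OF f]])
  have "CARD('a) * CARD('a) ^ 2 \<le> CARD('a) * card T"
    using card_kernel_ge[OF U linear_form_polar[OF f], of v] card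
    by (simp add: T_def power2_eq_square power3_eq_cube)
  hence cT: "CARD('a) ^ 2 \<le> card T" using q by simp
  hence qT: "CARD('a) < card T"
    using power_strict_increasing[OF _ q, of 1 2] by simp
  show False
  proof (cases "(2 :: 'a) = 0")
    case True
    \<comment> \<open>In characteristic 2, \<open>v\<close> is orthogonal to itself, so
      \<open>w\<close> must be chosen off its line. Squaring is bijective there and solves
      \<open>f w + c^2 * f v = 0\<close>.\<close>
    have "card (range (\<lambda>c. c *s v)) \<le> CARD('a)" by (rule card_image_le) simp
    also have "\<dots> < card T" by (rule qT)
    finally obtain w where w: "w \<in> T" "w \<notin> range (\<lambda>c. c *s v)" using exists by blast
    have "inj (\<lambda>x :: 'a. x\<^sup>2)"
    proof
      fix x y :: 'a assume "x\<^sup>2 = y\<^sup>2"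
      have "(x - y)\<^sup>2 = x\<^sup>2 + y\<^sup>2 - 2 * (x * y)" by (simp add: power2_eq_square algebra_simps)
      also have "\<dots> = 2 * (x\<^sup>2 - x * y)" using \<open>x\<^sup>2 = y\<^sup>2\<close> by (simp add: algebra_simps)
      finally show "x = y" using True by simp
    qed
    hence "surj (\<lambda>x :: 'a. x\<^sup>2)" by (rule finite_UNIV_inj_surj[rotated]) simp
    then obtain c where c: "c\<^sup>2 = - f w / f v" by (metis surjD)
    have "f (w + c *s v) = 0"
      using w(1) c fv by (simp add: quadratic_translate[OF f] T_def)
    moreover have "w + c *s v \<in> U" using w(1) v U by (auto simp: T_def vec.subspace_def)
    ultimately have "w = (- c) *s v" using aniso by (simp add: eq_neg_iff_add_eq_0 vector_smult_lneg)
    with w(2) show False by blast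
  next
    case False
    have cw: "card {0 :: 'a ^ 'n} < card T" using q qT by simp
    then obtain w where w: "w \<in> T" "w \<noteq> 0" using exists[OF cw] by auto
    hence fw: "f w \<noteq> 0" using aniso by (auto simp: T_def)
    define W where "W = {x\<in>T. polar f x w = 0}"
    have "CARD('a) * CARD('a) \<le> CARD('a) * card W"
      using order_trans[OF cT card_kernel_ge[OF T linear_form_polar[OF f], of w]]
      by (simp only: W_def power2_eq_square)
    hence "card {0 :: 'a ^ 'n} < card W" using q by simp
    from exists[OF this] obtain u where u: "u \<in> W" "u \<noteq> 0" by auto
    obtain x y where xy: "f v * x\<^sup>2 + f w * y\<^sup>2 = - f u"
      using exists_diagonal_value[OF fv fw] .
    define z where "z = (u + x *s v) + y *s w"
    have o: "polar f u v = 0" "polar f u w = 0" "polar f v w = 0" "polar f w u = 0" "polar f v u = 0"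
      using u w by (auto simp: W_def T_def polar_commute[of f v w] polar_commute[of f v u] polar_commute[of f w u])
    have "f z = f u + (f v * x\<^sup>2 + f w * y\<^sup>2)"
      by (simp only: z_def quadratic_translate[OF f] polar_simps[OF f] o) (simp add: algebra_simps)
    hence "f z = 0" by (simp add: xy)
    moreover have "z \<in> U" using u w v U by (auto simp: z_def W_def T_def vec.subspace_def)
    ultimately have "z = 0" using aniso by blast
    \<comment> \<open>Independence of \<open>u\<close>, \<open>v\<close>, \<open>w\<close> has not
      been shown, so \<open>z = 0\<close> is excluded by pairing with \<open>u\<close>:
      orthogonality leaves \<open>2 * f u\<close>.\<close>
    hence "polar f z u = 0" using polar_scale_left[OF f, of 0 0 u] by simp
    hence "f u = 0" using False by (simp add: z_def polar_simps[OF f] polar_self[OF f] o)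
    with aniso u show False by (auto simp: W_def T_def)
  qed
qed

text \<open>Two mutually orthogonal hyperbolic pairs \<open>(e1, e4)\<close> and
  \<open>(e2, e5)\<close>; index 3 is reserved for the vector orthogonal to both. The first two
  arguments span a line on the quadric.\<close>

definition hyperbolic :: "('a::field ^ 'n \<Rightarrow> 'a) \<Rightarrow> 'a ^ 'n \<Rightarrow> 'a ^ 'n \<Rightarrow> 'a ^ 'n \<Rightarrow> 'a ^ 'n \<Rightarrow> bool" where
  "hyperbolic f e1 e2 e4 e5 \<longleftrightarrow>
     f e1 = 0 \<and> f e2 = 0 \<and> f e4 = 0 \<and> f e5 = 0 \<and>
     polar f e1 e4 = 1 \<and> polar f e2 e5 = 1 \<and>
     polar f e1 e2 = 0 \<and> polar f e1 e5 = 0 \<and> polar f e4 e2 = 0 \<and> polar f e4 e5 = 0"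

lemma hyperbolic_facts:
  assumes "quadratic_form f" "hyperbolic f e1 e2 e4 e5"
  shows "f e1 = 0" "f e2 = 0" "f e4 = 0" "f e5 = 0"
    "polar f e1 e4 = 1" "polar f e2 e5 = 1" "polar f e4 e1 = 1" "polar f e5 e2 = 1"
    "polar f e1 e2 = 0" "polar f e1 e5 = 0" "polar f e4 e2 = 0" "polar f e4 e5 = 0"
    "polar f e2 e1 = 0" "polar f e5 e1 = 0" "polar f e2 e4 = 0" "polar f e5 e4 = 0"
    "polar f e1 e1 = 0" "polar f e2 e2 = 0" "polar f e4 e4 = 0" "polar f e5 e5 = 0"
  using assms(2) polar_commute[of f]
  by (auto simp: hyperbolic_def polar_self[OF assms(1)])

lemma hyperbolic_partner:
  assumes f: "quadratic_form f" and U: "vec.subspace U" "P \<in> U" "w \<in> U"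
    and P: "f P = 0" "polar f P w \<noteq> 0"
  obtains e where "e \<in> U" "f e = 0" "polar f P e = 1"
proof
  define v where "v = inverse (polar f P w) *s w"
  have Pv: "polar f P v = 1" using P by (simp add: v_def polar_simps[OF f])
  \<comment> \<open>Since \<open>f P = 0\<close> and \<open>polar f P v = 1\<close>, moving along
    \<open>P\<close> changes \<open>f v\<close> linearly, and this multiple cancels it.\<close>
  let ?e = "v + (- f v) *s P"
  show "?e \<in> U"
    using U unfolding v_def by (intro vec.subspace_add vec.subspace_scale)
  show "f ?e = 0"
    using Pv P by (simp only: quadratic_translate[OF f] polar_commute[of f v P]) simp
  show "polar f P ?e = 1"
    using Pv P by (simp only: polar_simps[OF f] polar_self[OF f]) simp
qed

section \<open>Coordinates adapted to a nonsingular quadric\<close>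

context square_field
begin

text \<open>A zero \<open>P\<close> and a partner span a hyperbolic plane; its complement has
  dimension 3, so it contains another zero, with a partner inside the complement.\<close>

lemma exists_hyperbolic:
  assumes f: "quadratic_form (f :: 'a ^ 5 \<Rightarrow> 'a)"
    and nonsing: "\<And>V. f V = 0 \<Longrightarrow> (\<And>x. polar f x V = 0) \<Longrightarrow> V = 0"
    and P: "f P = 0" "P \<noteq> 0"
  obtains e1 e2 e4 e5 where "hyperbolic f e1 e2 e4 e5"
proof -
  obtain w where "polar f w P \<noteq> 0" using nonsing P by blast
  hence Pw: "polar f P w \<noteq> 0" by (simp add: polar_commute[of f P w])
  obtain e where e: "f e = 0" "polar f P e = 1"
    using hyperbolic_partner[OF f vec.subspace_UNIV UNIV_I UNIV_I P(1) Pw] by blast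
  have PP: "polar f P P = 0" "polar f e e = 0" "polar f e P = 1"
    using P e by (simp_all add: polar_self[OF f] polar_commute[of f e P])
  define U1 where "U1 = {x. polar f x P = 0}"
  define U where "U = {x\<in>U1. polar f x e = 0}"
  have U1: "vec.subspace U1"
    using subspace_kernel[OF vec.subspace_UNIV linear_form_polar[OF f]] by (simp add: U1_def)
  have U: "vec.subspace U"
    unfolding U_def by (rule subspace_kernel[OF U1 linear_form_polar[OF f]])
  have "card U1 = t ^ 8"
    unfolding U1_def by (rule card_hyperplane[OF linear_form_polar[OF f], of e]) (simp add: PP)
  moreover have "card U1 = CARD('a) * card U"
    unfolding U_def by (rule card_kernel[OF U1 linear_form_polar[OF f], of P]) (simp_all add: U1_def PP e)
  ultimately have "t\<^sup>2 * card U = t\<^sup>2 * t ^ 6" by (simp add: card_field flip: power_add)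
  hence "card U = t ^ 6" by (simp only: square_t_cancel)
  hence "card U = CARD('a) ^ 3" by (simp add: card_field flip: power_mult)
  then obtain Q where Q: "Q \<in> U" "Q \<noteq> 0" "f Q = 0"
    using ternary_quadratic_isotropic[OF f U] by blast
  obtain y where y: "polar f y Q \<noteq> 0" using nonsing Q by blast
  \<comment> \<open>The projection of \<open>y\<close> to \<open>U\<close>, so that the partner is
    found inside \<open>U\<close>; its pairing with \<open>Q\<close> is that of
    \<open>y\<close>.\<close>
  define y' where "y' = y - polar f y e *s P - polar f y P *s e"
  have QP: "polar f Q P = 0" "polar f Q e = 0" using Q(1) by (auto simp: U_def U1_def)
  have "y' \<in> U"
    by (simp add: U_def U1_def y'_def polar_simps[OF f] PP e)
  moreover have "polar f Q y' \<noteq> 0"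
    using y by (simp add: y'_def polar_simps[OF f] QP polar_commute[of f y Q])
  ultimately obtain e' where e': "e' \<in> U" "f e' = 0" "polar f Q e' = 1"
    using hyperbolic_partner[OF f U Q(1) _ Q(3)] by blast
  have "hyperbolic f P Q e e'"
    using P e Q e' QP polar_commute[of f P Q] polar_commute[of f P e'] polar_commute[of f e Q]
      polar_commute[of f e e']
    by (auto simp: hyperbolic_def U_def U1_def)
  with that show ?thesis .
qed

lemma hyperbolic_coordinates:
  assumes f: "quadratic_form (f :: 'a ^ 5 \<Rightarrow> 'a)"
    and nonsing: "\<And>V. f V = 0 \<Longrightarrow> (\<And>x. polar f x V = 0) \<Longrightarrow> V = 0"
    and hyp: "hyperbolic f e1 e2 e4 e5"
  obtains e3 where "f e3 \<noteq> 0"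
    "polar f e3 e1 = 0" "polar f e3 e2 = 0" "polar f e3 e4 = 0" "polar f e3 e5 = 0"
    "\<And>x. \<exists>c. x = polar f x e4 *s e1 + polar f x e5 *s e2 + c *s e3 + polar f x e1 *s e4 + polar f x e2 *s e5"
proof -
  note hf = hyperbolic_facts[OF f hyp]
  note lin = linear_form_polar[OF f]
  define U1 where "U1 = {x. polar f x e1 = 0}"
  define U2 where "U2 = {x\<in>U1. polar f x e4 = 0}"
  define U3 where "U3 = {x\<in>U2. polar f x e2 = 0}"
  define U4 where "U4 = {x\<in>U3. polar f x e5 = 0}"
  have U1: "vec.subspace U1"
    using subspace_kernel[OF vec.subspace_UNIV lin] by (simp add: U1_def)
  have U2: "vec.subspace U2" unfolding U2_def by (rule subspace_kernel[OF U1 lin])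
  have U3: "vec.subspace U3" unfolding U3_def by (rule subspace_kernel[OF U2 lin])
  have U4: "vec.subspace U4" unfolding U4_def by (rule subspace_kernel[OF U3 lin])
  note Us = U1_def U2_def U3_def U4_def
  have "card U1 = t ^ 8"
    unfolding U1_def by (rule card_hyperplane[OF lin, of e4]) (simp add: hf)
  moreover have "card U1 = t\<^sup>2 * card U2" unfolding U2_def card_field[symmetric]
    by (rule card_kernel[OF U1 lin, of e1]) (simp_all add: Us hf)
  moreover have "card U2 = t\<^sup>2 * card U3" unfolding U3_def card_field[symmetric]
    by (rule card_kernel[OF U2 lin, of e5]) (simp_all add: Us hf)
  moreover have "card U3 = t\<^sup>2 * card U4" unfolding U4_def card_field[symmetric]
    by (rule card_kernel[OF U3 lin, of e2]) (simp_all add: Us hf)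
  ultimately have "t\<^sup>2 * (t\<^sup>2 * (t\<^sup>2 * card U4)) = t\<^sup>2 * (t\<^sup>2 * (t\<^sup>2 * t\<^sup>2))"
    by (simp flip: power_add)
  hence cU4: "card U4 = t\<^sup>2" by (simp only: square_t_cancel)
  have "\<not> U4 \<subseteq> {0}"
    using card_mono[of "{0}" U4] cU4 one_less_power[of t 2] t_ge_2 by auto
  then obtain e3 where e3: "e3 \<in> U4" "e3 \<noteq> 0" by auto
  have o: "polar f e3 e1 = 0" "polar f e3 e2 = 0" "polar f e3 e4 = 0" "polar f e3 e5 = 0"
    using e3 by (auto simp: Us)
  have "inj (\<lambda>c. c *s e3)" using e3(2) by (auto simp: inj_def vec.scale_right_imp_eq)
  hence "card (range (\<lambda>c. c *s e3)) = t\<^sup>2" by (simp add: card_image card_field)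
  moreover have "range (\<lambda>c. c *s e3) \<subseteq> U4" using e3 U4 by (auto simp: vec.subspace_def)
  ultimately have U4_eq: "U4 = range (\<lambda>c. c *s e3)"
    using cU4 by (metis card_subset_eq finite)
  have coords: "\<exists>c. x = polar f x e4 *s e1 + polar f x e5 *s e2 + c *s e3 + polar f x e1 *s e4 + polar f x e2 *s e5" for x
  proof -
    define y where "y = x - polar f x e4 *s e1 - polar f x e5 *s e2 - polar f x e1 *s e4 - polar f x e2 *s e5"
    have "y \<in> U4" by (simp add: Us y_def polar_simps[OF f] hf)
    then obtain c where "y = c *s e3" using U4_eq by auto
    hence "x = polar f x e4 *s e1 + polar f x e5 *s e2 + c *s e3 + polar f x e1 *s e4 + polar f x e2 *s e5"
      by (simp add: y_def algebra_simps)
    thus ?thesis ..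
  qed
  have "f e3 \<noteq> 0"
  proof
    \<comment> \<open>Then \<open>polar f e3 e3 = 2 * f e3 = 0\<close> as well, so \<open>e3\<close>
      is orthogonal to all five coordinate vectors and would be a singular zero.\<close>
    assume f3: "f e3 = 0"
    have "polar f x e3 = 0" for x
    proof -
      obtain c where c: "x = polar f x e4 *s e1 + polar f x e5 *s e2 + c *s e3 + polar f x e1 *s e4 + polar f x e2 *s e5"
        using coords by blast
      have "polar f e3 x = 0"
        by (subst c) (simp add: polar_simps[OF f] o polar_self[OF f] f3)
      thus ?thesis by (simp add: polar_commute[of f x e3])
    qed
    with nonsing f3 e3(2) show False by blast
  qed
  from that[OF this o coords] show ?thesis .
qed

text \<open>In the coordinates \<open>x = a e1 + b e2 + c e3 + d e4 + e e5\<close> the quadric is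
  \<open>a d + b e + f(e3) c\<^sup>2 = 0\<close>. For fixed \<open>(d, e) \<noteq> 0\<close> its vectors form \<open>t\<^sup>2\<close> lines (one for each \<open>c\<close>) with
  direction \<open>R = e e1 - d e2\<close>; those lying entirely on the hermitian variety satisfy an
  equation in \<open>c\<close> of degree 2 unless \<open>R\<close> is orthogonal to \<open>e1\<close> and \<open>e2\<close>.\<close>

lemma section_bound_hyperbolic:
  assumes f: "quadratic_form (f :: 'a ^ 5 \<Rightarrow> 'a)"
    and nonsing: "\<And>V. f V = 0 \<Longrightarrow> (\<And>x. polar f x V = 0) \<Longrightarrow> V = 0"
    and hyp: "hyperbolic f e1 e2 e4 e5"
    and line: "\<not> (herm e1 e1 = 0 \<and> herm e2 e2 = 0 \<and> herm e1 e2 = 0)"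
  shows "int (card {x. f x = 0 \<and> herm x x = 0}) \<le> section_bound"
proof -
  note hf = hyperbolic_facts[OF f hyp]
  obtain e3 where f3: "f e3 \<noteq> 0"
    and o: "polar f e3 e1 = 0" "polar f e3 e2 = 0" "polar f e3 e4 = 0" "polar f e3 e5 = 0"
    and coords: "\<And>x. \<exists>c. x = polar f x e4 *s e1 + polar f x e5 *s e2 + c *s e3 + polar f x e1 *s e4 + polar f x e2 *s e5"
    using hyperbolic_coordinates[OF f nonsing hyp] by blast
  have f_coords: "f (a *s e1 + b *s e2 + c *s e3 + d *s e4 + e *s e5) = a * d + b * e + c\<^sup>2 * f e3" for a b c d e
    by (simp add: quadratic_add[OF f] quadratic_scale[OF f] polar_simps[OF f] hf o
        polar_commute[of f e1 e3] polar_commute[of f e2 e3])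
  define R where "R d e = e *s e1 - d *s e2" for d e
  have R_lin: "herm (R d e) v = e * herm e1 v - d * herm e2 v" for d e v
    by (simp add: R_def herm_simps)
  define S where "S d e = {x. f x = 0 \<and> herm x x = 0 \<and> polar f x e1 = d \<and> polar f x e2 = e}" for d e
  define A where "A = {x. f x = 0 \<and> herm x x = 0}"
  have A_le: "card A \<le> (\<Sum>(d, e)\<in>UNIV. card (S d e))"
  proof -
    have "A = (\<Union>(d, e)\<in>UNIV. S d e)" by (auto simp: A_def S_def)
    thus ?thesis using card_UN_le[of UNIV "\<lambda>(d, e). S d e"] by (simp add: case_prod_unfold)
  qed
  have S00: "card (S 0 0) \<le> t ^ 4"
  proof -
    have "S 0 0 \<subseteq> (\<lambda>(a, b). a *s e1 + b *s e2) ` UNIV"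
    proof
      fix x assume x: "x \<in> S 0 0"
      then obtain a b c where x': "x = a *s e1 + b *s e2 + c *s e3 + 0 *s e4 + 0 *s e5"
        using coords[of x] by (auto simp: S_def)
      hence "c = 0" using x f3 unfolding S_def by (simp only: mem_Collect_eq f_coords) simp
      with x' show "x \<in> (\<lambda>(a, b). a *s e1 + b *s e2) ` UNIV" by auto
    qed
    hence "card (S 0 0) \<le> card ((\<lambda>(a, b). a *s e1 + b *s e2) ` (UNIV :: ('a \<times> 'a) set))"
      by (rule card_mono[rotated]) simp
    also have "\<dots> \<le> CARD('a \<times> 'a)" by (rule card_image_le) simp
    also have "\<dots> = t ^ 4" by (simp add: card_field flip: power_add)
    finally show ?thesis .
  qed
  \<comment> \<open>For fixed \<open>c\<close> the equation \<open>a d + b e = - f(e3) c^2\<close>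
    has the particular solution \<open>- f(e3) c^2 (a0, b0)\<close>, giving \<open>z c\<close>, and
    the homogeneous solutions are the multiples of \<open>(e, - d)\<close>, giving
    \<open>R d e\<close>. The product of \<open>z c\<close> with \<open>R d e\<close> is thus
    quadratic in \<open>c\<close>.\<close>
  have S_le: "\<exists>z. (\<forall>c. herm (z c) (R d e) = - (f e3 * herm E (R d e)) * c\<^sup>2 + herm e3 (R d e) * c + herm (d *s e4 + e *s e5) (R d e)) \<and>
      card (S d e) \<le> (\<Sum>c\<in>UNIV. card {s. herm (z c + s *s R d e) (z c + s *s R d e) = 0})"
    if ab: "a0 * d + b0 * e = 1" and E: "E = a0 *s e1 + b0 *s e2" for d e a0 b0 E
  proof (intro exI conjI allI)
    define z where "z c = (- (f e3 * c\<^sup>2)) *s E + c *s e3 + (d *s e4 + e *s e5)" for c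
    show "herm (z c) (R d e) = - (f e3 * herm E (R d e)) * c\<^sup>2 + herm e3 (R d e) * c + herm (d *s e4 + e *s e5) (R d e)" for c
      by (simp only: z_def herm_add_left herm_scale_left) (simp add: algebra_simps)
    have "S d e \<subseteq> (\<Union>c\<in>UNIV. (\<lambda>s. z c + s *s R d e) ` {s. herm (z c + s *s R d e) (z c + s *s R d e) = 0})"
    proof
      fix x assume x: "x \<in> S d e"
      then obtain a b c where x': "x = a *s e1 + b *s e2 + c *s e3 + d *s e4 + e *s e5"
        using coords[of x] by (auto simp: S_def)
      define a' where "a' = a + f e3 * c\<^sup>2 * a0"
      define b' where "b' = b + f e3 * c\<^sup>2 * b0"
      have "f x = 0" using x by (simp add: S_def)
      hence *: "a * d + b * e + c\<^sup>2 * f e3 = 0" unfolding x' f_coords .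
      have **: "a' * d + b' * e = 0"
        using * ab unfolding a'_def b'_def by algebra
      \<comment> \<open>Cramer's rule: \<open>a0 * d + b0 * e = 1\<close> recovers the multiple
        \<open>s\<close> from the homogeneous solution.\<close>
      define s where "s = a' * b0 - b' * a0"
      have "s * e = a'" "s * d = - b'"
        using ** ab unfolding s_def by algebra+
      hence ab': "a = s * e - f e3 * c\<^sup>2 * a0" "b = - (s * d) - f e3 * c\<^sup>2 * b0"
        by (simp_all add: a'_def b'_def)
      hence xz: "x = z c + s *s R d e"
        unfolding x' ab' z_def R_def E by (simp add: vec_eq_iff algebra_simps)
      moreover have "herm x x = 0" using x by (simp add: S_def)
      ultimately show "x \<in> (\<Union>c\<in>UNIV. (\<lambda>s. z c + s *s R d e) ` {s. herm (z c + s *s R d e) (z c + s *s R d e) = 0})"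
        by blast
    qed
    hence "card (S d e) \<le> card (\<Union>c\<in>UNIV. (\<lambda>s. z c + s *s R d e) ` {s. herm (z c + s *s R d e) (z c + s *s R d e) = 0})"
      by (rule card_mono[rotated]) simp
    also have "\<dots> \<le> (\<Sum>c\<in>UNIV. card ((\<lambda>s. z c + s *s R d e) ` {s. herm (z c + s *s R d e) (z c + s *s R d e) = 0}))"
      by (rule card_UN_le) simp
    also have "\<dots> \<le> (\<Sum>c\<in>UNIV. card {s. herm (z c + s *s R d e) (z c + s *s R d e) = 0})"
      by (intro sum_mono card_image_le) simp
    finally show "card (S d e) \<le> (\<Sum>c\<in>UNIV. card {s. herm (z c + s *s R d e) (z c + s *s R d e) = 0})" .
  qed
  have ex_ab: "\<exists>a0 b0. a0 * d + b0 * e = 1" if "d \<noteq> 0 \<or> e \<noteq> 0" for d e :: 'a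
  proof (cases "d = 0")
    case True
    with that show ?thesis by (intro exI[of _ 0] exI[of _ "inverse e"]) auto
  next
    case False
    thus ?thesis by (intro exI[of _ "inverse d"] exI[of _ 0]) auto
  qed
  have S_aniso: "card (S d e) \<le> t ^ 3 + t\<^sup>2" if de: "d \<noteq> 0 \<or> e \<noteq> 0" and h: "herm (R d e) (R d e) \<noteq> 0" for d e
  proof -
    obtain a0 b0 where "a0 * d + b0 * e = 1" using ex_ab[OF de] by blast
    from S_le[OF this refl] obtain z where
      "card (S d e) \<le> (\<Sum>c\<in>(UNIV :: 'a set). card {s. herm (z c + s *s R d e) (z c + s *s R d e) = 0})"
      by blast
    also have "\<dots> \<le> (\<Sum>c\<in>(UNIV :: 'a set). t + 1)"
      by (intro sum_mono card_isotropic_translates_aniso_le h)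
    also have "\<dots> = t ^ 3 + t\<^sup>2" by (simp add: card_field power2_eq_square power3_eq_cube)
    finally show ?thesis .
  qed
  have S_any: "card (S d e) \<le> t ^ 4" if de: "d \<noteq> 0 \<or> e \<noteq> 0" for d e
  proof -
    obtain a0 b0 where "a0 * d + b0 * e = 1" using ex_ab[OF de] by blast
    from S_le[OF this refl] obtain z where
      "card (S d e) \<le> (\<Sum>c\<in>(UNIV :: 'a set). card {s. herm (z c + s *s R d e) (z c + s *s R d e) = 0})"
      by blast
    also have "\<dots> \<le> (\<Sum>c\<in>(UNIV :: 'a set). CARD('a))"
      by (intro sum_mono card_mono) auto
    also have "\<dots> = t ^ 4" by (simp add: card_field flip: power_add)
    finally show ?thesis .
  qed
  have S_secant: "card (S d e) \<le> t ^ 3 + 2 * (t\<^sup>2 - t)"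
    if de: "d \<noteq> 0 \<or> e \<noteq> 0" and h: "herm (R d e) (R d e) = 0"
      and nd: "herm e1 (R d e) \<noteq> 0 \<or> herm e2 (R d e) \<noteq> 0" for d e
  proof -
    obtain a0 b0 where ab: "a0 * d + b0 * e = 1" using ex_ab[OF de] by blast
    define E where "E = a0 *s e1 + b0 *s e2"
    obtain z where z: "\<And>c. herm (z c) (R d e) = - (f e3 * herm E (R d e)) * c\<^sup>2 + herm e3 (R d e) * c + herm (d *s e4 + e *s e5) (R d e)"
      and le: "card (S d e) \<le> (\<Sum>c\<in>UNIV. card {s. herm (z c + s *s R d e) (z c + s *s R d e) = 0})"
      using S_le[OF ab E_def] by blast
    \<comment> \<open>\<open>E\<close> and \<open>R d e\<close> span the same plane as
      \<open>e1\<close> and \<open>e2\<close>. As \<open>R d e\<close> is isotropic, a vector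
      \<open>e1\<close> or \<open>e2\<close> not orthogonal to it forces the leading coefficient to
      be nonzero.\<close>
    have "e1 = d *s E + b0 *s R d e" "e2 = e *s E - a0 *s R d e"
    proof -
      have "e1 = (a0 * d + b0 * e) *s e1" "e2 = (a0 * d + b0 * e) *s e2" by (simp_all add: ab)
      thus "e1 = d *s E + b0 *s R d e" "e2 = e *s E - a0 *s R d e"
        by (simp_all add: E_def R_def vec_eq_iff algebra_simps)
    qed
    hence "herm e1 (R d e) = d * herm E (R d e)" "herm e2 (R d e) = e * herm E (R d e)"
      using h by (metis herm_add_left herm_scale_left mult_zero_right add.right_neutral,
          metis herm_diff_left herm_scale_left mult_zero_right diff_zero)
    with nd have HE: "herm E (R d e) \<noteq> 0" by auto
    define B where "B = {c. herm (z c) (R d e) = 0}"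
    have cB: "card B \<le> 2"
      unfolding B_def z using card_roots_quadratic[of "- (f e3 * herm E (R d e))"] HE f3 by simp
    \<comment> \<open>Each line gives \<open>t\<close>, except for at most two values of
      \<open>c\<close> for which the whole line may be isotropic.\<close>
    have "card (S d e) \<le> (\<Sum>c\<in>UNIV. t + (if c \<in> B then t\<^sup>2 - t else 0))"
    proof (rule order_trans[OF le sum_mono])
      fix c
      have "card {s. herm (z c + s *s R d e) (z c + s *s R d e) = 0} \<le> CARD('a)" by (intro card_mono) auto
      thus "card {s. herm (z c + s *s R d e) (z c + s *s R d e) = 0} \<le> t + (if c \<in> B then t\<^sup>2 - t else 0)"
        using card_isotropic_translates_secant[OF h, of "z c"] t_ge_2
        by (auto simp: B_def card_field power2_eq_square)
    qed
    also have "\<dots> = t ^ 3 + card B * (t\<^sup>2 - t)"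
      by (simp add: sum.distrib card_field sum.If_cases power2_eq_square power3_eq_cube)
    also have "\<dots> \<le> t ^ 3 + 2 * (t\<^sup>2 - t)" using cB by simp
    finally show ?thesis .
  qed
  have cUV: "card (UNIV :: ('a \<times> 'a) set) = t ^ 4" by (simp add: card_field flip: power_add)
  have "int (card A) \<le> section_bound"
  proof (cases "\<exists>d0 e0. (d0 \<noteq> 0 \<or> e0 \<noteq> 0) \<and> herm e1 (R d0 e0) = 0 \<and> herm e2 (R d0 e0) = 0")
    \<comment> \<open>The form restricted to the span of \<open>e1\<close> and \<open>e2\<close> has
      no radical, so \<open>S_aniso\<close> and \<open>S_secant\<close> cover all
      \<open>(d, e)\<close> other than \<open>(0, 0)\<close>.\<close>
    case False
    define m where "m = t ^ 3 + 2 * (t\<^sup>2 - t)"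
    have "2 * t \<le> t\<^sup>2"
      unfolding power2_eq_square by (rule mult_right_mono[OF t_ge_2]) simp
    hence "t\<^sup>2 \<le> 2 * (t\<^sup>2 - t)" by linarith
    hence Sm: "card (S d e) \<le> m" if "d \<noteq> 0 \<or> e \<noteq> 0" for d e
      using S_aniso[OF that] S_secant[OF that] that False unfolding m_def
      by (cases "herm (R d e) (R d e) = 0") (blast, simp)
    have "card A \<le> (\<Sum>p\<in>(UNIV :: ('a \<times> 'a) set). if p = (0, 0) then t ^ 4 else m)"
    proof (rule order_trans[OF A_le sum_mono])
      fix p :: "'a \<times> 'a"
      obtain d e where p: "p = (d, e)" by (cases p)
      show "(case p of (d, e) \<Rightarrow> card (S d e)) \<le> (if p = (0, 0) then t ^ 4 else m)"
        using S00 Sm[of d e] by (cases "d = 0 \<and> e = 0") (auto simp: p)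
    qed
    also have "\<dots> = t ^ 4 + m * (t ^ 4 - 1)"
    proof -
      have "(\<Sum>p\<in>UNIV - {(0, 0) :: 'a \<times> 'a}. if p = (0, 0) then t ^ 4 else m) =
          (\<Sum>p\<in>UNIV - {(0, 0) :: 'a \<times> 'a}. m)" by (rule sum.cong) auto
      also have "\<dots> = m * (t ^ 4 - 1)"
        by (simp only: sum_constant card_Diff_singleton UNIV_I cUV) simp
      finally show ?thesis
        using sum.remove[of UNIV "(0, 0) :: 'a \<times> 'a" "\<lambda>p. if p = (0, 0) then t ^ 4 else m"] by simp
    qed
    finally have "int (card A) \<le> int (t ^ 4 + m * (t ^ 4 - 1))" by (simp only: of_nat_le_iff)
    also have "\<dots> = int t ^ 4 + (int t ^ 3 + 2 * (int t ^ 2 - int t)) * (int t ^ 4 - 1)"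
    proof -
      have "1 \<le> t ^ 4" "t \<le> t\<^sup>2" using t_ge_2 by (simp_all add: power2_eq_square)
      thus ?thesis by (simp only: m_def of_nat_hom of_nat_diff)
    qed
    also have "\<dots> = int t ^ 7 + 2 * int t ^ 6 - 2 * int t ^ 5 + int t ^ 4 - int t ^ 3 - 2 * int t ^ 2 + 2 * int t"
      by algebra
    finally show ?thesis
      using power_t_bounds of_nat_mono[OF \<open>2 * t \<le> t\<^sup>2\<close>, where 'a = int]
      unfolding section_bound_def of_nat_hom by linarith
  next
    case True
    then obtain d0 e0 where 0: "d0 \<noteq> 0 \<or> e0 \<noteq> 0" "herm e1 (R d0 e0) = 0" "herm e2 (R d0 e0) = 0" by blast
    \<comment> \<open>\<open>R d0 e0\<close> lies in the radical of the restricted form. An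
      isotropic direction not proportional to it would make the form vanish on the whole span,
      against \<open>line\<close>; \<open>D\<close> is the determinant expressing \<open>e1\<close>
      and \<open>e2\<close> through the two directions.\<close>
    have h: "herm (R d e) (R d e) \<noteq> 0" if ne: "e * d0 \<noteq> d * e0" for d e
    proof
      assume RR: "herm (R d e) (R d e) = 0"
      define D where "D = e * d0 - d * e0"
      have D: "D *s e1 = d0 *s R d e - d *s R d0 e0" "D *s e2 = e0 *s R d e - e *s R d0 e0" "D \<noteq> 0"
        using ne by (simp_all add: D_def R_def vec_eq_iff algebra_simps)
      have R0: "herm (R d e) (R d0 e0) = 0" "herm (R d0 e0) (R d0 e0) = 0"
        by (simp_all only: R_lin 0) simp_all
      hence R0': "herm (R d0 e0) (R d e) = 0" by (simp add: herm_eq_0_commute)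
      have "herm (D *s e1) (D *s e1) = 0" "herm (D *s e2) (D *s e2) = 0" "herm (D *s e1) (D *s e2) = 0"
        unfolding D by (simp_all add: herm_simps RR R0 R0')
      with D(3) line show False by (simp add: herm_simps)
    qed
    define L where "L = {p. snd p * d0 = fst p * e0}"
    have "L \<subseteq> (\<lambda>s. (s * d0, s * e0)) ` UNIV"
    proof
      fix p assume "p \<in> L"
      then obtain d e where p: "p = (d, e)" "e * d0 = d * e0" by (cases p) (auto simp: L_def)
      show "p \<in> (\<lambda>s. (s * d0, s * e0)) ` UNIV"
      proof (cases "d0 = 0")
        case True
        with p 0 show ?thesis by (intro image_eqI[of _ _ "e / e0"]) auto
      next
        case False
        with p show ?thesis by (intro image_eqI[of _ _ "d / d0"]) (auto simp: field_simps)
      qed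
    qed
    hence "card L \<le> card ((\<lambda>s. (s * d0, s * e0)) ` UNIV)" by (rule card_mono[rotated]) simp
    also have "\<dots> \<le> t\<^sup>2" unfolding card_field[symmetric] by (rule card_image_le) simp
    finally have cL: "card L \<le> t\<^sup>2" .
    \<comment> \<open>Guarantees that the natural-number difference in the following sum is not
      truncated.\<close>
    have "int (t ^ 3 + t\<^sup>2) \<le> int (t ^ 4)"
      using power_t_bounds unfolding of_nat_hom by linarith
    hence tt: "t ^ 3 + t\<^sup>2 \<le> t ^ 4" by (simp only: of_nat_le_iff)
    have "card A \<le> (\<Sum>p\<in>UNIV. (t ^ 3 + t\<^sup>2) + (if p \<in> L then t ^ 4 - (t ^ 3 + t\<^sup>2) else 0))"
    proof (rule order_trans[OF A_le sum_mono])
      fix p :: "'a \<times> 'a"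
      obtain d e where p: "p = (d, e)" by (cases p)
      show "(case p of (d, e) \<Rightarrow> card (S d e)) \<le> (t ^ 3 + t\<^sup>2) + (if p \<in> L then t ^ 4 - (t ^ 3 + t\<^sup>2) else 0)"
      proof (cases "p \<in> L")
        case True
        have "card (S d e) \<le> t ^ 4" using S00 S_any[of d e] by (cases "d = 0 \<and> e = 0") auto
        with True tt show ?thesis by (simp add: p)
      next
        case False
        hence "e * d0 \<noteq> d * e0" by (simp add: p L_def)
        moreover from this have "d \<noteq> 0 \<or> e \<noteq> 0" by auto
        ultimately show ?thesis using S_aniso[of d e] h[of e d] False by (simp add: p)
      qed
    qed
    also have "\<dots> = (t ^ 3 + t\<^sup>2) * t ^ 4 + card L * (t ^ 4 - (t ^ 3 + t\<^sup>2))"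
      by (simp only: sum.distrib sum_constant cUV) (simp add: sum.If_cases distrib_right)
    also have "\<dots> \<le> (t ^ 3 + t\<^sup>2) * t ^ 4 + t\<^sup>2 * (t ^ 4 - (t ^ 3 + t\<^sup>2))"
      using cL by (intro add_mono mult_right_mono) auto
    finally have "int (card A) \<le> int ((t ^ 3 + t\<^sup>2) * t ^ 4 + t\<^sup>2 * (t ^ 4 - (t ^ 3 + t\<^sup>2)))" by (simp only: of_nat_le_iff)
    also have "\<dots> = (int t ^ 3 + int t ^ 2) * int t ^ 4 + int t ^ 2 * (int t ^ 4 - (int t ^ 3 + int t ^ 2))"
      by (simp only: of_nat_diff[OF tt] of_nat_hom)
    also have "\<dots> = int t ^ 7 + 2 * int t ^ 6 - int t ^ 5 - int t ^ 4" by algebra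
    finally show ?thesis
      using power_t_bounds unfolding section_bound_def by linarith
  qed
  thus ?thesis by (simp add: A_def)
qed

text \<open>If the lines \<open>\<langle>e1, e2\<rangle>\<close>, \<open>\<langle>e1, e5\<rangle>\<close>, \<open>\<langle>e4, e2\<rangle>\<close>, \<open>\<langle>e4, e5\<rangle>\<close> and all
  \<open>\<langle>e1 - d e2, d e4 + e5\<rangle>\<close> of the quadric lay on the hermitian variety, then
  \<open>H(e1, e4) d\<^sup>t = H(e2, e5) d\<close> for all \<open>d\<close>, both coefficients would vanish, and the form would be
  degenerate.\<close>

lemma section_bound_nonsingular:
  assumes f: "quadratic_form (f :: 'a ^ 5 \<Rightarrow> 'a)"
    and nonsing: "\<And>V. f V = 0 \<Longrightarrow> (\<And>x. polar f x V = 0) \<Longrightarrow> V = 0"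
    and hyp: "hyperbolic f e1 e2 e4 e5"
  shows "int (card {x. f x = 0 \<and> herm x x = 0}) \<le> section_bound"
proof (rule ccontr)
  assume large: "\<not> ?thesis"
  note hf = hyperbolic_facts[OF f hyp]
  \<comment> \<open>A violation of the bound would put the line spanned by the first two vectors of
    every hyperbolic system on the hermitian variety; varying the system yields the
    contradiction.\<close>
  have iso: "herm a a = 0 \<and> herm b b = 0 \<and> herm a b = 0 \<and> herm b a = 0" if "hyperbolic f a b c d" for a b c d
    using section_bound_hyperbolic[OF f nonsing that] large herm_eq_0_commute[of a b] by blast
  have "hyperbolic f e1 e5 e4 e2" "hyperbolic f e4 e2 e1 e5" "hyperbolic f e4 e5 e1 e2"
    by (simp_all add: hyperbolic_def hf)
  note iso4 = iso[OF hyp] iso[OF this(1)] iso[OF this(2)] iso[OF this(3)]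
  have eq: "d ^ t * herm e1 e4 = d * herm e2 e5" for d
  proof -
    have "hyperbolic f (e1 + (- d) *s e2) (e5 + d *s e4) e4 e2"
      unfolding hyperbolic_def
      by (simp only: quadratic_translate[OF f] polar_simps[OF f] hf) simp
    from iso[OF this] have "herm (e1 + (- d) *s e2) (e5 + d *s e4) = 0" by blast
    thus ?thesis by (simp only: herm_simps iso4) simp
  qed
  \<comment> \<open>Taking 1 in \<open>eq\<close> equates the two coefficients; an element outside
    the fixed field then makes them vanish.\<close>
  obtain d where "d ^ t \<noteq> (d :: 'a)" using exists_not_fixed by blast
  with eq[of 1] eq[of d] have "herm e1 e4 = 0" "herm e2 e5 = 0" by auto
  hence iso5: "herm e4 e1 = 0" "herm e5 e2 = 0" by (simp_all add: herm_eq_0_commute)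
  obtain e3 where coords: "\<And>x. \<exists>c. x = polar f x e4 *s e1 + polar f x e5 *s e2 + c *s e3 + polar f x e1 *s e4 + polar f x e2 *s e5"
    using hyperbolic_coordinates[OF f nonsing hyp] by blast
  \<comment> \<open>The form now vanishes on the span of \<open>e1\<close>, \<open>e2\<close>,
    \<open>e4\<close>, \<open>e5\<close>, so a vector of this plane that is orthogonal to
    \<open>e3\<close> is orthogonal to everything.\<close>
  have perp: "v = 0" if v: "v = x *s e1 + y *s e2" "herm e3 v = 0" for v x y
  proof (rule ccontr)
    assume "v \<noteq> 0"
    then obtain w where w: "herm w v \<noteq> 0" using herm_nondegenerate by blast
    obtain c where c: "w = polar f w e4 *s e1 + polar f w e5 *s e2 + c *s e3 + polar f w e1 *s e4 + polar f w e2 *s e5"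
      using coords by blast
    have "herm e1 v = 0" "herm e2 v = 0" "herm e4 v = 0" "herm e5 v = 0"
      unfolding v(1) by (simp_all add: herm_simps iso4 iso5)
    hence "herm w v = 0"
      by (subst c) (simp add: herm_add_left herm_scale_left v(2))
    with w show False by blast
  qed
  have zero: "x = 0 \<and> y = 0" if "x *s e1 + y *s e2 = 0" for x y
  proof -
    have "polar f (x *s e1 + y *s e2) e4 = x" "polar f (x *s e1 + y *s e2) e5 = y"
      by (simp_all add: polar_simps[OF f] hf)
    thus ?thesis unfolding that using polar_scale_left[OF f, of 0 0] by simp
  qed
  \<comment> \<open>One linear condition on a plane has a nonzero solution. These are its
    coefficients, conjugated because the second argument is semilinear; their vanishing makes
    \<open>e1\<close> orthogonal to \<open>e3\<close>, and \<open>e1\<close> itself is the final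
    contradiction.\<close>
  define x where "x = herm e3 e2 ^ t"
  define y where "y = - (herm e3 e1 ^ t)"
  have "herm e3 (x *s e1 + y *s e2) = 0"
    by (simp only: herm_simps x_def y_def frobenius_minus power_t_power_t) simp
  from zero[OF perp[OF refl this]] have "herm e3 e1 = 0"
    using t_ge_2 by (simp add: y_def)
  hence "herm e3 (1 *s e1 + 0 *s e2) = 0" by simp
  from zero[OF perp[OF refl this]] show False by simp
qed

lemma section_bound_quadric:
  assumes f: "quadratic_form (f :: 'a ^ 5 \<Rightarrow> 'a)" "f z \<noteq> 0"
  shows "int (card {x. f x = 0 \<and> herm x x = 0}) \<le> section_bound"
proof (cases "\<exists>l w. linear_form l \<and> l w \<noteq> 0 \<and> (\<forall>x. l x = 0 \<longrightarrow> f x = 0)")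
  case True
  thus ?thesis using section_bound_reducible[OF f] by blast
next
  case False
  hence irr: "\<exists>x. l x = 0 \<and> f x \<noteq> 0" if "linear_form l" "l w \<noteq> 0" for l w
    using that by blast
  show ?thesis
  proof (cases "\<exists>V. V \<noteq> 0 \<and> f V = 0 \<and> (\<forall>x. polar f x V = 0)")
    case True
    then obtain V where V: "V \<noteq> 0" "f V = 0" "\<And>x. polar f x V = 0" by blast
    show ?thesis by (rule section_bound_singular[OF f(1) _ V]) (rule irr)
  next
    case nonsing: False
    show ?thesis
    proof (cases "\<exists>P. f P = 0 \<and> P \<noteq> 0")
      case True
      then obtain P where P: "f P = 0" "P \<noteq> 0" by blast
      obtain e1 e2 e4 e5 where "hyperbolic f e1 e2 e4 e5"
        using exists_hyperbolic[OF f(1) _ P] nonsing by blast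
      thus ?thesis using section_bound_nonsingular[OF f(1)] nonsing by blast
    next
      case False
      hence "{x. f x = 0 \<and> herm x x = 0} \<subseteq> {0}" by blast
      hence "card {x. f x = 0 \<and> herm x x = 0} \<le> 1" using card_mono[of "{0 :: 'a ^ 5}"] by fastforce
      thus ?thesis using power_t_bounds unfolding section_bound_def by linarith
    qed
  qed
qed

end

section \<open>Quadratic monomials\<close>

definition quad_monomial :: "5 \<times> 5 \<Rightarrow> (5 \<Rightarrow>\<^sub>0 nat)" where
  "quad_monomial p = Poly_Mapping.single (fst p) 1 + Poly_Mapping.single (snd p) 1"

definition quad_pairs :: "(5 \<times> 5) set" where
  "quad_pairs = {(i, j). i \<le> j}"

text \<open>Swapping coordinates matches the pairs above and below the diagonal, so
  \<open>25 = 2 * 10 + 5\<close>.\<close>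

lemma card_quad_pairs: "card quad_pairs = 15"
proof -
  let ?L = "{(i, j). i < j} :: (5 \<times> 5) set" and ?G = "{(i, j). j < i} :: (5 \<times> 5) set"
  let ?D = "range (\<lambda>i. (i, i)) :: (5 \<times> 5) set"
  have "bij_betw prod.swap ?L ?G"
    by (rule bij_betw_byWitness[where f' = prod.swap]) auto
  hence "card ?G = card ?L" by (simp add: bij_betw_same_card)
  moreover have D: "card ?D = 5" by (simp add: card_image inj_on_def)
  moreover have "card (?L \<union> ?D) = card ?L + card ?D"
    by (rule card_Un_disjoint) auto
  moreover have "?L \<union> ?D = quad_pairs" by (auto simp: quad_pairs_def)
  moreover have "card (quad_pairs \<union> ?G) = card quad_pairs + card ?G"
    by (rule card_Un_disjoint) (auto simp: quad_pairs_def)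
  moreover have "quad_pairs \<union> ?G = UNIV" by (auto simp: quad_pairs_def)
  ultimately show ?thesis by simp
qed

lemma lookup_quad_monomial:
  "Poly_Mapping.lookup (quad_monomial p) k = (if k = fst p then 1 else 0) + (if k = snd p then 1 else 0)"
  by (auto simp: quad_monomial_def lookup_add lookup_single when_def)

lemma inj_on_quad_monomial: "inj_on quad_monomial quad_pairs"
proof (rule inj_onI)
  fix p r assume p: "p \<in> quad_pairs" "r \<in> quad_pairs" "quad_monomial p = quad_monomial r"
  have "{fst s, snd s} = {k. Poly_Mapping.lookup (quad_monomial s) k \<noteq> 0}" for s
    by (auto simp: lookup_quad_monomial)
  hence "{fst p, snd p} = {fst r, snd r}" using p(3) by metis
  with p(1,2) show "p = r"
    by (cases p; cases r) (auto simp: quad_pairs_def doubleton_eq_iff)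
qed

lemma quad_monomials: "{m. (\<Sum>i\<in>UNIV. Poly_Mapping.lookup m i) = 2} = quad_monomial ` quad_pairs"
proof (intro equalityI subsetI)
  fix m :: "5 \<Rightarrow>\<^sub>0 nat" assume "m \<in> {m. (\<Sum>i\<in>UNIV. Poly_Mapping.lookup m i) = 2}"
  hence m: "(\<Sum>i\<in>UNIV. Poly_Mapping.lookup m i) = 2" by simp
  then obtain i where i: "Poly_Mapping.lookup m i \<noteq> 0" by (metis sum.neutral zero_neq_numeral)
  define g where "g k = Poly_Mapping.lookup m k - (if k = i then 1 else 0)" for k
  have mg: "Poly_Mapping.lookup m k = g k + (if k = i then 1 else 0)" for k
    using i by (auto simp: g_def)
  have "sum g UNIV = 1"
    using m unfolding mg by (simp add: sum.distrib)
  then obtain j where j: "g j = 1" "\<And>k. k \<noteq> j \<Longrightarrow> g k = 0"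
    using sum_eq_Suc0_iff[of UNIV g] by auto
  define p where "p = (min i j, max i j)"
  have "m = quad_monomial p"
    by (rule poly_mapping_eqI) (use j in \<open>auto simp: lookup_quad_monomial mg p_def min_def max_def\<close>)
  moreover have "p \<in> quad_pairs" by (auto simp: p_def quad_pairs_def min_le_iff_disj le_max_iff_disj)
  ultimately show "m \<in> quad_monomial ` quad_pairs" by blast
next
  fix m assume "m \<in> quad_monomial ` quad_pairs"
  thus "m \<in> {m. (\<Sum>i\<in>UNIV. Poly_Mapping.lookup m i) = 2}"
    by (auto simp: lookup_quad_monomial sum.distrib)
qed

lemma prod_quad_monomial:
  "(\<Prod>k\<in>UNIV. (x :: 'a::field ^ 5) $ k ^ Poly_Mapping.lookup (quad_monomial p) k) = x $ fst p * x $ snd p"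
proof -
  have "(\<Prod>k\<in>UNIV. x $ k ^ (if k = i then 1 else 0)) = x $ i" for i
  proof -
    have "(\<Prod>k\<in>UNIV. x $ k ^ (if k = i then 1 else 0)) = (\<Prod>k\<in>UNIV. if k = i then x $ i else 1)"
      by (rule prod.cong) auto
    thus ?thesis by simp
  qed
  thus ?thesis by (simp only: lookup_quad_monomial power_add prod.distrib)
qed

lemma quadratic_form_sum:
  fixes c :: "5 \<times> 5 \<Rightarrow> 'a::field"
  shows "quadratic_form (\<lambda>x. \<Sum>p\<in>A. c p * (x $ fst p * x $ snd p))"
proof -
  have "polar (\<lambda>x. \<Sum>p\<in>A. c p * (x $ fst p * x $ snd p)) x y =
      (\<Sum>p\<in>A. c p * (x $ fst p * y $ snd p + y $ fst p * x $ snd p))" for x y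
    by (simp add: polar_def algebra_simps flip: sum.distrib sum_subtractf)
  thus ?thesis
    by (auto simp: quadratic_form_def linear_form_def sum_distrib_left algebra_simps power2_eq_square
        simp flip: sum.distrib)
qed

lemma poly5_eval_quadratic:
  assumes "f \<in> forms 2"
  shows "poly5_eval f x = (\<Sum>p\<in>quad_pairs. Poly_Mapping.lookup f (quad_monomial p) * (x $ fst p * x $ snd p))"
proof -
  have "Poly_Mapping.keys f \<subseteq> quad_monomial ` quad_pairs"
    using assms unfolding quad_monomials[symmetric] by (auto simp: forms_def)
  hence "poly5_eval f x = (\<Sum>m\<in>quad_monomial ` quad_pairs. Poly_Mapping.lookup f m * (\<Prod>i\<in>UNIV. x $ i ^ Poly_Mapping.lookup m i))"
    unfolding poly5_eval_def by (intro sum.mono_neutral_left) (auto simp: in_keys_iff)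
  also have "\<dots> = (\<Sum>p\<in>quad_pairs. Poly_Mapping.lookup f (quad_monomial p) * (x $ fst p * x $ snd p))"
    by (subst sum.reindex[OF inj_on_quad_monomial]) (simp add: prod_quad_monomial)
  finally show ?thesis .
qed

text \<open>Evaluation at \<open>axis i 1\<close> isolates the square coefficients, and then at
  \<open>axis i 1 + axis j 1\<close> the mixed ones. Hence a nonzero form of degree 2 is a nonzero
  function even over a small field.\<close>

lemma quadratic_coefficients_zero:
  fixes c :: "5 \<times> 5 \<Rightarrow> 'a::field"
  assumes zero: "\<And>x :: 'a ^ 5. (\<Sum>p\<in>quad_pairs. c p * (x $ fst p * x $ snd p)) = 0" and p: "p \<in> quad_pairs"
  shows "c p = 0"
proof -
  obtain i j where ij: "p = (i, j)" "i \<le> j" using p by (auto simp: quad_pairs_def)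
  have diag: "c (i, i) = 0" for i
  proof -
    have "0 = (\<Sum>p\<in>quad_pairs. c p * (axis i 1 $ fst p * axis i 1 $ snd p))"
      by (rule zero[symmetric])
    also have "\<dots> = (\<Sum>p\<in>quad_pairs. if p = (i, i) then c (i, i) else 0)"
      by (rule sum.cong) (auto simp: axis_def)
    finally show ?thesis by (simp add: quad_pairs_def)
  qed
  show ?thesis
  proof (cases "i = j")
    case False
    have "0 = (\<Sum>p\<in>quad_pairs. c p * ((axis i 1 + axis j 1) $ fst p * (axis i 1 + axis j 1) $ snd p))"
      by (rule zero[symmetric])
    also have "\<dots> = (\<Sum>p\<in>quad_pairs. if p = (i, j) then c (i, j) else 0)"
      by (rule sum.cong) (use False ij diag in \<open>auto simp: axis_def quad_pairs_def\<close>)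
    finally show ?thesis using p by (simp add: ij)
  qed (use diag ij in simp)
qed

definition quad_poly :: "(5 \<times> 5 \<Rightarrow> 'a::field) \<Rightarrow> 'a poly5" where
  "quad_poly c = (\<Sum>p\<in>quad_pairs. Poly_Mapping.single (quad_monomial p) (c p))"

lemma lookup_quad_poly:
  "Poly_Mapping.lookup (quad_poly c) m = (\<Sum>p\<in>quad_pairs. if m = quad_monomial p then c p else 0)"
  by (auto simp: quad_poly_def lookup_sum lookup_single when_def intro!: sum.cong)

lemma lookup_quad_poly_monomial:
  assumes "p \<in> quad_pairs"
  shows "Poly_Mapping.lookup (quad_poly c) (quad_monomial p) = c p"
proof -
  have "(\<Sum>r\<in>quad_pairs. if quad_monomial p = quad_monomial r then c r else 0) =
      (\<Sum>r\<in>quad_pairs. if r = p then c p else 0)"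
    by (rule sum.cong) (use assms inj_on_quad_monomial in \<open>auto dest: inj_onD\<close>)
  thus ?thesis using assms by (simp add: lookup_quad_poly)
qed

lemma quad_poly_in_forms: "quad_poly c \<in> forms 2"
proof -
  have "m \<in> quad_monomial ` quad_pairs" if "m \<in> Poly_Mapping.keys (quad_poly c)" for m
  proof (rule ccontr)
    assume "m \<notin> quad_monomial ` quad_pairs"
    hence "Poly_Mapping.lookup (quad_poly c) m = 0"
      unfolding lookup_quad_poly by (intro sum.neutral) auto
    with that show False by (simp add: in_keys_iff)
  qed
  thus ?thesis unfolding forms_def quad_monomials[symmetric] by blast
qed

section \<open>The code\<close>

lemma card_projective_image:
  fixes S :: "('a::{field,finite} ^ 5) set"
  assumes "0 \<notin> S" and "\<And>c x. x \<in> S \<Longrightarrow> c \<noteq> 0 \<Longrightarrow> c *s x \<in> S"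
  shows "card S = (CARD('a) - 1) * card (abs_proj4 ` S)"
proof -
  have "card {x\<in>S. abs_proj4 x = P} = CARD('a) - 1" if P: "P \<in> abs_proj4 ` S" for P
  proof -
    obtain y where y: "y \<in> S" "P = abs_proj4 y" using P by blast
    hence "y \<noteq> 0" using assms(1) by auto
    have "{x\<in>S. abs_proj4 x = P} = (\<lambda>c. c *s y) ` (UNIV - {0})"
    proof (intro equalityI subsetI)
      fix x assume "x \<in> {x\<in>S. abs_proj4 x = P}"
      hence "x \<in> S" "abs_proj4 y = abs_proj4 x" using y by auto
      moreover have "x \<noteq> 0" using \<open>x \<in> S\<close> assms(1) by auto
      ultimately have "proportional y x" using \<open>y \<noteq> 0\<close> by (simp add: abs_proj4_eq_iff)
      thus "x \<in> (\<lambda>c. c *s y) ` (UNIV - {0})" by (auto simp: proportional_def)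
    next
      fix x assume "x \<in> (\<lambda>c. c *s y) ` (UNIV - {0})"
      then obtain c where c: "c \<noteq> 0" "x = c *s y" by auto
      hence "x \<in> S" using assms(2) y by blast
      hence "x \<noteq> 0" using assms(1) by auto
      have "proportional y x" using c \<open>x \<noteq> 0\<close> \<open>y \<noteq> 0\<close> by (auto simp: proportional_def)
      thus "x \<in> {x\<in>S. abs_proj4 x = P}"
        using \<open>x \<in> S\<close> abs_proj4_eq_iff[OF \<open>y \<noteq> 0\<close> \<open>x \<noteq> 0\<close>] y by simp
    qed
    moreover have "inj (\<lambda>c. c *s y)"
      using \<open>y \<noteq> 0\<close> by (auto simp: inj_def vec.scale_right_imp_eq)
    hence "inj_on (\<lambda>c. c *s y) (UNIV - {0})" by (rule inj_on_subset) simp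
    ultimately show ?thesis by (simp add: card_image card_Diff_subset)
  qed
  moreover have "card S = (\<Sum>P\<in>abs_proj4 ` S. card {x\<in>S. abs_proj4 x = P})"
    using sum.group[of S "abs_proj4 ` S" abs_proj4 "\<lambda>_. 1 :: nat"] by simp
  ultimately show ?thesis by simp
qed

context square_field
begin

definition hermitian_points :: "'a proj4 set" where
  "hermitian_points = hermitian_variety t"

lemma herm_self: "herm x x = (\<Sum>i\<in>UNIV. x $ i ^ (t + 1))"
  by (simp add: herm_def)

lemma hermitian_points_eq: "hermitian_points = abs_proj4 ` {x. x \<noteq> 0 \<and> herm x x = 0}"
  by (simp add: hermitian_points_def hermitian_variety_def herm_self)

lemma finite_hermitian_points: "finite hermitian_points"
  by (simp add: hermitian_points_eq)

lemma card_section: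
  assumes "f \<in> forms 2"
  shows "int (card {x. poly5_eval f x = 0 \<and> herm x x = 0}) =
    (int t ^ 2 - 1) * int (card (hermitian_points \<inter> zero_set f)) + 1"
proof -
  let ?S = "{x. x \<noteq> 0 \<and> poly5_eval f x = 0 \<and> herm x x = 0}"
  have "hermitian_points \<inter> zero_set f = abs_proj4 ` ?S"
  proof (intro equalityI subsetI)
    fix P assume P: "P \<in> hermitian_points \<inter> zero_set f"
    obtain x where x: "P = abs_proj4 x" "x \<noteq> 0" "herm x x = 0"
      using P by (auto simp: hermitian_points_eq)
    obtain y where y: "P = abs_proj4 y" "y \<noteq> 0" "poly5_eval f y = 0"
      using P by (auto simp: zero_set_def)
    obtain c where "x = c *s y"
      using abs_proj4_eq_iff[of y x] x y by (auto simp: proportional_def)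
    hence "poly5_eval f x = 0" using y poly5_eval_scale[OF assms] by simp
    with x show "P \<in> abs_proj4 ` ?S" by blast
  qed (auto simp: hermitian_points_eq zero_set_def)
  moreover have "card ?S = (CARD('a) - 1) * card (abs_proj4 ` ?S)"
    by (rule card_projective_image) (auto simp: poly5_eval_scale[OF assms] herm_simps)
  \<comment> \<open>The zero vector is a common zero that represents no point; it is the summand
    1.\<close>
  moreover have "{x. poly5_eval f x = 0 \<and> herm x x = 0} = insert 0 ?S"
    using poly5_eval_scale[OF assms, of 0 0] by auto
  hence "card {x. poly5_eval f x = 0 \<and> herm x x = 0} = card ?S + 1" by simp
  moreover have "1 \<le> t\<^sup>2" using t_ge_2 by simp
  ultimately show ?thesis by (simp add: card_field of_nat_diff)
qed

lemma t_square_minus_1_pos: "0 < int t ^ 2 - 1"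
  using power_t_bounds by linarith

lemma card_hermitian_points: "card hermitian_points = (t ^ 2 + 1) * (t ^ 5 + 1)"
proof -
  \<comment> \<open>The section by the zero form is the whole variety.\<close>
  have "(0 :: 'a poly5) \<in> forms 2" by (simp add: forms_def)
  moreover have "poly5_eval 0 x = 0" for x :: "'a ^ 5" by (simp add: poly5_eval_def)
  moreover from this have "hermitian_points \<inter> zero_set 0 = hermitian_points"
    by (auto simp: hermitian_points_eq zero_set_def)
  ultimately have "(int t ^ 2 - 1) * int (card hermitian_points) + 1 = int t ^ 9 - int t ^ 5 + int t ^ 4"
    using card_section[of 0] card_isotropic_5 by simp
  hence "(int t ^ 2 - 1) * int (card hermitian_points) = (int t ^ 2 - 1) * ((int t ^ 2 + 1) * (int t ^ 5 + 1))"
    by algebra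
  hence "int (card hermitian_points) = (int t ^ 2 + 1) * (int t ^ 5 + 1)"
    using t_square_minus_1_pos by simp
  hence "int (card hermitian_points) = int ((t ^ 2 + 1) * (t ^ 5 + 1))"
    by (simp only: of_nat_hom)
  thus ?thesis by (simp only: of_nat_eq_iff)
qed

lemma card_points_section_le:
  assumes "f \<in> forms 2" "f \<noteq> 0"
  shows "card (hermitian_points \<inter> zero_set f) \<le> 2 * t ^ 5 + t ^ 3 + 2 * t\<^sup>2 + 1"
proof -
  have "\<exists>z. poly5_eval f z \<noteq> 0"
  proof (rule ccontr)
    assume "\<not> ?thesis"
    hence "Poly_Mapping.lookup f (quad_monomial p) = 0" if "p \<in> quad_pairs" for p
      using quadratic_coefficients_zero[of "\<lambda>p. Poly_Mapping.lookup f (quad_monomial p)" p] that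
      by (simp add: poly5_eval_quadratic[OF assms(1)])
    moreover have "Poly_Mapping.keys f \<subseteq> quad_monomial ` quad_pairs"
      using assms unfolding quad_monomials[symmetric] by (auto simp: forms_def)
    ultimately have "Poly_Mapping.keys f = {}"
      using in_keys_iff[of _ f] by blast
    with assms(2) show False by simp
  qed
  then obtain z where z: "poly5_eval f z \<noteq> 0" by blast
  have "quadratic_form (poly5_eval f)"
    using quadratic_form_sum[where A = quad_pairs and c = "\<lambda>p. Poly_Mapping.lookup f (quad_monomial p)"]
    by (simp add: poly5_eval_quadratic[OF assms(1), abs_def])
  from section_bound_quadric[OF this z]
  have "(int t ^ 2 - 1) * int (card (hermitian_points \<inter> zero_set f)) \<le> section_bound - 1"
    unfolding card_section[OF assms(1)] by linarith
  also have "\<dots> = (int t ^ 2 - 1) * (2 * int t ^ 5 + int t ^ 3 + 2 * int t ^ 2 + 1)"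
    unfolding section_bound_def by algebra
  finally have "int (card (hermitian_points \<inter> zero_set f)) \<le> 2 * int t ^ 5 + int t ^ 3 + 2 * int t ^ 2 + 1"
    using t_square_minus_1_pos by simp
  hence "int (card (hermitian_points \<inter> zero_set f)) \<le> int (2 * t ^ 5 + t ^ 3 + 2 * t\<^sup>2 + 1)"
    by (simp only: of_nat_hom)
  thus ?thesis by (simp only: of_nat_le_iff)
qed

text \<open>Coordinate hyperplanes have anisotropic, mutually orthogonal poles: exactly the
  configuration in which both estimates of the two-hyperplane bound are equalities.\<close>

lemma card_points_section_max:
  obtains f where "f \<in> forms 2" "f \<noteq> 0"
    "card (hermitian_points \<inter> zero_set f) = 2 * t ^ 5 + t ^ 3 + 2 * t\<^sup>2 + 1"
proof -
  have "(3 :: 5) \<noteq> 4" by simp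
  then obtain i j :: 5 where ij: "i < j" by (meson neq_iff)
  define c :: "5 \<times> 5 \<Rightarrow> 'a" where "c p = (if p = (i, j) then 1 else 0)" for p
  have p: "(i, j) \<in> quad_pairs" using ij by (simp add: quad_pairs_def)
  have f: "quad_poly c \<in> forms 2" by (rule quad_poly_in_forms)
  have f0: "quad_poly c \<noteq> 0"
    using lookup_quad_poly_monomial[OF p, of c] by (auto simp: c_def)
  have ev: "poly5_eval (quad_poly c) x = x $ i * x $ j" for x
  proof -
    have "poly5_eval (quad_poly c) x = (\<Sum>p\<in>quad_pairs. c p * (x $ fst p * x $ snd p))"
      by (simp add: poly5_eval_quadratic[OF f] lookup_quad_poly_monomial)
    also have "\<dots> = (\<Sum>p\<in>quad_pairs. if p = (i, j) then x $ i * x $ j else 0)"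
      by (rule sum.cong) (auto simp: c_def)
    finally show ?thesis using p by simp
  qed
  have c4: "int (card {x :: 'a ^ 5. x $ k = 0 \<and> herm x x = 0}) = int t ^ 7 + int t ^ 4 - int t ^ 3" for k
  proof -
    have "card (- {k}) = 4" by (simp add: Compl_eq_Diff_UNIV card_Diff_subset)
    with card_coordinate_isotropic(2)[of "- {k}"]
    have "int t * int (card {x :: 'a ^ 5. x $ k = 0 \<and> herm x x = 0}) = int t ^ 8 + (int t - 1) * int t ^ 4"
      by simp
    also have "\<dots> = int t * (int t ^ 7 + int t ^ 4 - int t ^ 3)" by algebra
    finally show ?thesis using t_ge_2 by simp
  qed
  have c3: "int (card {x :: 'a ^ 5. (x $ i = 0 \<and> x $ j = 0) \<and> herm x x = 0}) = int t ^ 5 - int t ^ 3 + int t ^ 2"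
  proof -
    have "card (- {i, j}) = 3" using ij by (simp add: Compl_eq_Diff_UNIV card_Diff_subset)
    with card_coordinate_isotropic(2)[of "- {i, j}"]
    have "int t * int (card {x :: 'a ^ 5. (x $ i = 0 \<and> x $ j = 0) \<and> herm x x = 0}) = int t ^ 6 + (- 1) * (int t - 1) * int t ^ 3"
      by (simp add: all_conj_distrib imp_conjR)
    also have "\<dots> = int t * (int t ^ 5 - int t ^ 3 + int t ^ 2)" by algebra
    finally show ?thesis using t_ge_2 by simp
  qed
  have "{x :: 'a ^ 5. x $ i = 0 \<and> herm x x = 0} \<union> {x. x $ j = 0 \<and> herm x x = 0} =
      {x. poly5_eval (quad_poly c) x = 0 \<and> herm x x = 0}"
    "{x :: 'a ^ 5. x $ i = 0 \<and> herm x x = 0} \<inter> {x. x $ j = 0 \<and> herm x x = 0} =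
      {x. (x $ i = 0 \<and> x $ j = 0) \<and> herm x x = 0}"
    by (auto simp: ev)
  with card_Un_Int[of "{x :: 'a ^ 5. x $ i = 0 \<and> herm x x = 0}" "{x. x $ j = 0 \<and> herm x x = 0}"]
  have "int (card {x :: 'a ^ 5. x $ i = 0 \<and> herm x x = 0}) + int (card {x :: 'a ^ 5. x $ j = 0 \<and> herm x x = 0}) =
      int (card {x. poly5_eval (quad_poly c) x = 0 \<and> herm x x = 0}) +
      int (card {x :: 'a ^ 5. (x $ i = 0 \<and> x $ j = 0) \<and> herm x x = 0})"
    by simp
  hence "(int t ^ 2 - 1) * int (card (hermitian_points \<inter> zero_set (quad_poly c))) =
      (int t ^ 2 - 1) * (2 * int t ^ 5 + int t ^ 3 + 2 * int t ^ 2 + 1)"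
    unfolding c4 c3 card_section[OF f] by algebra
  hence "int (card (hermitian_points \<inter> zero_set (quad_poly c))) = 2 * int t ^ 5 + int t ^ 3 + 2 * int t ^ 2 + 1"
    using t_square_minus_1_pos by simp
  hence "int (card (hermitian_points \<inter> zero_set (quad_poly c))) = int (2 * t ^ 5 + t ^ 3 + 2 * t\<^sup>2 + 1)"
    by (simp only: of_nat_hom)
  hence "card (hermitian_points \<inter> zero_set (quad_poly c)) = 2 * t ^ 5 + t ^ 3 + 2 * t\<^sup>2 + 1"
    by (simp only: of_nat_eq_iff)
  with that f f0 show ?thesis by blast
qed

section \<open>Weights, dimension and minimum distance\<close>

lemma length_minus_section:
  "(t ^ 2 + 1) * (t ^ 5 + 1) - (2 * t ^ 5 + t ^ 3 + 2 * t\<^sup>2 + 1) = t ^ 7 - t ^ 5 - t ^ 3 - t ^ 2"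
  by (simp add: algebra_simps flip: power_add)

text \<open>Ensures that the differences in \<open>d\<close> are not truncated and that the weight
  bound separates nonzero forms from 0.\<close>

lemma min_weight_pos: "0 < t ^ 7 - t ^ 5 - t ^ 3 - t ^ 2"
proof -
  have "int (t ^ 5 + t ^ 3 + t ^ 2) < int (t ^ 7)"
    using power_t_bounds unfolding of_nat_hom by linarith
  hence "t ^ 5 + t ^ 3 + t ^ 2 < t ^ 7" by (simp only: of_nat_less_iff)
  thus ?thesis by linarith
qed

lemma weight_ge:
  assumes "f \<in> forms 2" "f \<noteq> 0"
  shows "t ^ 7 - t ^ 5 - t ^ 3 - t ^ 2 \<le> weight (codeword 2 hermitian_points f)"
  unfolding weight_codeword[OF assms(1) finite_hermitian_points] card_hermitian_points
    length_minus_section[symmetric]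
  by (rule diff_le_mono2) (rule card_points_section_le[OF assms])

text \<open>A nonzero form has positive weight, so the distance bound already gives injectivity of
  the evaluation map.\<close>

lemma codeword_eq_0_iff:
  assumes "f \<in> forms 2"
  shows "codeword 2 hermitian_points f = 0 \<longleftrightarrow> f = 0"
proof
  assume "codeword 2 hermitian_points f = 0"
  hence "weight (codeword 2 hermitian_points f) = 0" by (simp add: weight_def)
  with weight_ge[OF assms] min_weight_pos show "f = 0" by fastforce
next
  assume "f = 0"
  thus "codeword 2 hermitian_points f = 0"
    by (auto simp: codeword_def point_value_def normalized_value_def poly5_eval_def fun_eq_iff)
qed

definition monomial_word :: "5 \<times> 5 \<Rightarrow> 'a proj4 \<Rightarrow> 'a" where
  "monomial_word p = codeword 2 hermitian_points (quad_poly (\<lambda>r. if r = p then 1 else 0))"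

lemma sum_word_scale: "(\<Sum>p\<in>A. word_scale (c p) (w p)) P = (\<Sum>p\<in>A. c p * w p P)"
  by (induction A rule: infinite_finite_induct) (auto simp: word_scale_def)

lemma codeword_eq_sum:
  assumes f: "f \<in> forms 2"
  shows "codeword 2 hermitian_points f =
    (\<Sum>p\<in>quad_pairs. word_scale (Poly_Mapping.lookup f (quad_monomial p)) (monomial_word p))"
proof
  fix P :: "'a proj4"
  define x where "x = rep_proj4 P"
  have "monomial_word p P = (if P \<in> hermitian_points then x $ fst p * x $ snd p / (x $ (LEAST i. x $ i \<noteq> 0))\<^sup>2 else 0)"
    if "p \<in> quad_pairs" for p
  proof -
    have "(\<Sum>r\<in>quad_pairs. (if r = p then 1 else 0) * (x $ fst r * x $ snd r)) =
        (\<Sum>r\<in>quad_pairs. if r = p then x $ fst p * x $ snd p else 0)"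
      by (rule sum.cong) auto
    thus ?thesis
      using that by (simp add: monomial_word_def codeword_def point_value_def normalized_value_def
          poly5_eval_quadratic[OF quad_poly_in_forms] lookup_quad_poly_monomial x_def)
  qed
  hence "(\<Sum>p\<in>quad_pairs. word_scale (Poly_Mapping.lookup f (quad_monomial p)) (monomial_word p)) P =
      (\<Sum>p\<in>quad_pairs. Poly_Mapping.lookup f (quad_monomial p) *
        (if P \<in> hermitian_points then x $ fst p * x $ snd p / (x $ (LEAST i. x $ i \<noteq> 0))\<^sup>2 else 0))"
    by (simp add: sum_word_scale)
  also have "\<dots> = codeword 2 hermitian_points f P"
    by (simp add: codeword_def point_value_def normalized_value_def poly5_eval_quadratic[OF f]
        x_def sum_divide_distrib)
  finally show "codeword 2 hermitian_points f P =
      (\<Sum>p\<in>quad_pairs. word_scale (Poly_Mapping.lookup f (quad_monomial p)) (monomial_word p)) P" ..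
qed

lemma codeword_quad_poly:
  "codeword 2 hermitian_points (quad_poly c) = (\<Sum>p\<in>quad_pairs. word_scale (c p) (monomial_word p))"
  by (simp add: codeword_eq_sum[OF quad_poly_in_forms] lookup_quad_poly_monomial)

lemma monomial_words_relation:
  assumes "(\<Sum>p\<in>quad_pairs. word_scale (c p) (monomial_word p)) = 0" "p \<in> quad_pairs"
  shows "c p = 0"
proof -
  have "quad_poly c = 0"
    using assms(1) codeword_eq_0_iff[OF quad_poly_in_forms, of c] by (simp add: codeword_quad_poly)
  thus ?thesis using lookup_quad_poly_monomial[OF assms(2), of c] by simp
qed

text \<open>Independence concerns the set of words, so the words of the fifteen monomials must also
  be distinct; two equal ones would give a relation with coefficients 1 and -1.\<close>

lemma inj_on_monomial_word: "inj_on monomial_word quad_pairs"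
proof (rule inj_onI, rule ccontr)
  fix p r assume pr: "p \<in> quad_pairs" "r \<in> quad_pairs" "monomial_word p = monomial_word r" "p \<noteq> r"
  define c :: "5 \<times> 5 \<Rightarrow> 'a" where "c s = (if s = p then 1 else if s = r then - 1 else 0)" for s
  have "(\<Sum>s\<in>quad_pairs. word_scale (c s) (monomial_word s)) = 0"
  proof
    fix P :: "'a proj4"
    have "(\<Sum>s\<in>quad_pairs. c s * monomial_word s P) =
        (\<Sum>s\<in>quad_pairs. (if s = p then monomial_word p P else 0) - (if s = r then monomial_word r P else 0))"
      by (rule sum.cong) (use pr(4) in \<open>auto simp: c_def\<close>)
    also have "\<dots> = 0" using pr by (simp add: sum_subtractf)
    finally show "(\<Sum>s\<in>quad_pairs. word_scale (c s) (monomial_word s)) P = 0 P"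
      by (simp add: sum_word_scale)
  qed
  from monomial_words_relation[OF this pr(1)] show False by (simp add: c_def)
qed

lemma independent_monomial_words: "word.independent (monomial_word ` quad_pairs)"
proof (rule word.independent_if_scalars_zero)
  fix c w
  assume "(\<Sum>w\<in>monomial_word ` quad_pairs. word_scale (c w) w) = 0" "w \<in> monomial_word ` quad_pairs"
  thus "c w = 0"
    using monomial_words_relation[of "\<lambda>p. c (monomial_word p)"]
    by (auto simp: sum.reindex[OF inj_on_monomial_word])
qed simp

lemma functional_code_eq_span:
  "functional_code 2 hermitian_points = word.span (monomial_word ` quad_pairs)"
proof (intro equalityI subsetI)
  fix w assume "w \<in> functional_code 2 hermitian_points"
  then obtain f where f: "f \<in> forms 2" and w: "w = codeword 2 hermitian_points f"
    by (auto simp: functional_code_def)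
  show "w \<in> word.span (monomial_word ` quad_pairs)"
    unfolding w codeword_eq_sum[OF f]
    by (intro word.span_sum word.span_scale word.span_base imageI)
next
  fix w assume "w \<in> word.span (monomial_word ` quad_pairs)"
  then obtain c where "w = (\<Sum>v\<in>monomial_word ` quad_pairs. word_scale (c v) v)"
    by (auto simp: word.span_finite)
  also have "\<dots> = codeword 2 hermitian_points (quad_poly (\<lambda>p. c (monomial_word p)))"
    by (simp add: sum.reindex[OF inj_on_monomial_word] codeword_quad_poly)
  finally show "w \<in> functional_code 2 hermitian_points"
    using quad_poly_in_forms by (auto simp: functional_code_def)
qed

lemma dim_functional_code: "word.dim (functional_code 2 hermitian_points) = 15"
proof -
  have "word.dim (functional_code 2 hermitian_points) = card (monomial_word ` quad_pairs)"
    unfolding functional_code_eq_span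
    by (rule word.dim_span_eq_card_independent[OF independent_monomial_words])
  thus ?thesis by (simp add: card_image[OF inj_on_monomial_word] card_quad_pairs)
qed

lemma min_distance_functional_code:
  "min_distance (functional_code 2 hermitian_points) = t ^ 7 - t ^ 5 - t ^ 3 - t ^ 2"
  unfolding min_distance_def
proof (rule Min_eqI)
  have "weight w \<le> card hermitian_points" if "w \<in> functional_code 2 hermitian_points" for w
    using that weight_codeword[OF _ finite_hermitian_points] by (auto simp: functional_code_def)
  hence "weight ` (functional_code 2 hermitian_points - {0}) \<subseteq> {..card hermitian_points}" by auto
  thus "finite (weight ` (functional_code 2 hermitian_points - {0}))"
    by (rule finite_subset) simp
  show "t ^ 7 - t ^ 5 - t ^ 3 - t ^ 2 \<le> y"
    if y: "y \<in> weight ` (functional_code 2 hermitian_points - {0})" for y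
  proof -
    obtain f where "f \<in> forms 2" "codeword 2 hermitian_points f \<noteq> 0" "y = weight (codeword 2 hermitian_points f)"
      using y by (auto simp: functional_code_def)
    thus ?thesis using weight_ge codeword_eq_0_iff by blast
  qed
  obtain f where f: "f \<in> forms 2" "f \<noteq> 0"
    and card: "card (hermitian_points \<inter> zero_set f) = 2 * t ^ 5 + t ^ 3 + 2 * t\<^sup>2 + 1"
    by (rule card_points_section_max)
  have "weight (codeword 2 hermitian_points f) = t ^ 7 - t ^ 5 - t ^ 3 - t ^ 2"
    unfolding weight_codeword[OF f(1) finite_hermitian_points] card card_hermitian_points
    by (rule length_minus_section)
  moreover have "codeword 2 hermitian_points f \<in> functional_code 2 hermitian_points - {0}"
    using f codeword_eq_0_iff by (auto simp: functional_code_def)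
  ultimately show "t ^ 7 - t ^ 5 - t ^ 3 - t ^ 2 \<in> weight ` (functional_code 2 hermitian_points - {0})"
    by (metis imageI)
qed

end

theorem theorem6p3:
  fixes t :: nat and X :: "'a::{field,finite} proj4 set"
  assumes "primepow t" and "CARD('a) = t ^ 2"
    and "X = hermitian_variety t"
  shows "is_code X (functional_code 2 X)
           ((t ^ 2 + 1) * (t ^ 5 + 1)) 15 (t ^ 7 - t ^ 5 - t ^ 3 - t ^ 2)"
proof -
  interpret square_field t "TYPE('a)"
    using assms(1,2) by unfold_locales
  have X: "X = hermitian_points" by (simp add: assms(3) hermitian_points_def)
  have "functional_code 2 X \<subseteq> words X"
    by (auto simp: functional_code_def words_def codeword_def)
  thus ?thesis
    unfolding is_code_def X
    using finite_hermitian_points card_hermitian_points dim_functional_code min_distance_functional_code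
    by (simp add: functional_code_eq_span)
qed

end
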